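(* Let $\nu$ be a probability measure on $(\mathcal E,\mathcal B(\mathcal E))$, let $(\tau,Z)$ be an independent-cycles nominal impulse policy, and let $(\check\Omega,\check{\mathcal F},\mathbb P_\nu^{(\tau,Z)})$, with $\mathbb P_\nu^{(\tau,Z)}=\int_{\mathcal E}\mathbb P_x^{(\tau,Z)}\,\nu(dx)$, and $X$ be the corresponding probability space and coordinate process; set $\tau_0=0$. Then the cycles $\{X(t):\tau_k\le t<\tau_{k+1}\}$ for $k\in\mathbb N_0=\{0,1,2,\dots\}$ are independent; that is, $\{X(t):0\le t<\tau_1\}$, $\{X(t):\tau_1\le t<\tau_2\}$, $\dots$ are independent stochastic processes under $\mathbb P_\nu^{(\tau,Z)}$.
   Context: Setting. $\mathcal E$ is a complete separable metric space, $\Omega=D_{\mathcal E}[0,\infty)$ is the space of càdlàg functions, $X(t,\omega)=\omega(t)$ is the coordinate process, $\mathcal F=\sigma(X(t):t\ge0)$, $\mathcal F_t=\sigma(X(s):0\le s\le t)$, $\mathcal F_{t-}=\sigma(X(s):0\le s<t)$ for $t>0$ and $\mathcal F_{0-}=\{\emptyset,\Omega\}$. $\{\mathbb P_x:x\in\mathcal E\}$ is a family of probability measures on $(\Omega,\mathcal F)$ such that $(\Omega,\mathcal F,X,\{\mathcal F_t\},\{\mathbb P_x\})$ is a Markov family: (1) for each $F\in\mathcal F$, $x\mapsto\mathbb P_x(F)$ is universally measurable; (2) $\mathbb P_x(X(0)=x)=1$; (3) $\mathbb P_x(X(s+t)\in B\mid\mathcal F_s)=\mathbb P_x(X(s+t)\in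 B\mid X(s))$ $\mathbb P_x$-a.s.; (4) $\mathbb P_x(X(s+t)\in B\mid X(s)=y)=\mathbb P_y(X(t)\in B)$ for $\mathbb P_xX(s)^{-1}$-a.e. $y$; for all $x\in\mathcal E$, $s,t\ge0$, $B\in\mathcal B(\mathcal E)$. Each $\mathbb P_x$ has its support in $C_{\mathcal E}[0,\infty)$. Augmented space. $\check\Omega=\mathcal E\times\Omega$, $\check{\mathcal F}=\mathcal B(\mathcal E)\otimes\mathcal F$; elements are $\check\omega=(\check\omega(0-),\check\omega(\cdot))$; $X(0-,\check\omega)=\check\omega(0-)$, $X(t,\check\omega)=\check\omega(t)$ for $t\ge0$; $\check{\mathcal F}_t=\mathcal B(\mathcal E)\otimes\mathcal F_t$, $\check{\mathcal F}_{t-}=\mathcal B(\mathcal E)\otimes\mathcal F_{t-}$ for $t\ge0$. $\check{\mathbb P}_x$ is the extension of $\mathbb P_x$ to $(\check\Omega,\check{\mathcal F})$ putting full mass on $\{\check\omega(0-)=x\}$. Impulse mechanism. $(\mathcal Z,\mathfrak Z)$ is a measurable space and $\{Q_{(y,z)}:(y,z)\in\mathcal E\times\mathcal Z\}$ is a family of probability measures on $\mathcal E$ such that $(y,z)\mapsto Q_{(y,z)}(\Gamma)$ is $\mathcal B(\mathcal E)\otimes\mathfrak Z$-measurable for each $\Gamma\in\mathcal B(\mathcal E)$. For a stopping time $\eta$, $\mathcal F_{\eta-}=\sigma(\{A\cap\{\eta>t\}:A\in\mathcal F_{t-},\,t\ge0\})$ and $\check{\mathcal F}_{\eta-}=\mathcal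 B(\mathcal E)\otimes\mathcal F_{\eta-}$. Nominal impulse policy. A sequence $(\tau,Z)=\{(\tau_k,Z_k):k\in\mathbb N\}$ defined on $(\check\Omega,\check{\mathcal F})$ with: $\tau_1$ an $\{\check{\mathcal F}_{t-}\}$-stopping time and, for $k\ge2$, $\tau_k$ an $\{\mathcal F_{t-}\}$-stopping time (evaluated on $\check\Omega$ through the projection $\check\omega\mapsto\check\omega(\cdot)$, as is $Z_k$ for $k\ge 2$); $\tau_{k+1}>\tau_k$ on $\{\tau_k<\infty\}$ for each $k\in\mathbb N$; $\lim_{k\to\infty}\tau_k=\infty$; and $Z_k$ a $\mathcal Z$-valued, $\mathcal F_{\tau_k-}/\mathfrak Z$-measurable random variable ($\check{\mathcal F}_{\tau_1-}/\mathfrak Z$-measurable for $k=1$). Set $\tau_0=0$ and $Y_k=X(\tau_k-)$ on $\{\tau_k<\infty\}$. Independent-cycles nominal impulse policy. A nominal impulse policy such that for each $k\in\mathbb N$: (a) there exists a random time $\sigma_k$ such that $\tau_k=\tau_{k-1}+\sigma_k\circ\theta_{\tau_{k-1}}$ on the set $\{\tau_{k-1}<\infty\}$, where $\theta_{\tau_0}$ is the identity mapping on $\check\Omega$ and, for $k\ge2$, $\theta_{\tau_{k-1}}(\check\omega)=\check\omega(\tau_{k-1}(\check\omega)+\cdot)\in\Omega$; and (b) on the event $\{\tau_k<\infty\}$, the intervention $(\tau_k,Z_k)$ is such that $Q_{(Y_k(\omega),Z_k(\omega))}$ does not depend on $\omega$. The measures $\mathbb P_x^{(\tau,Z)}$.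 Fix $\bar e\in\mathcal E$, $\bar z\in\mathcal Z$. Let $\Omega_0=\check\Omega$, $\Omega_k=\Omega$ for $k\ge1$, with $\sigma$-algebras $\mathscr F_0=\check{\mathcal F}$, $\mathscr F_k=\mathcal F$ and coordinate processes $X_k$; $\widetilde\Omega=\prod_{k\ge0}\Omega_k$, $\widetilde{\mathcal G}=\bigotimes_{k\ge0}\mathscr F_k$; $\mathbf e_k=(\omega_0,\dots,\omega_k)$. Put $\widetilde\tau_0=0$, $\bar\omega_0=\omega_0$ and recursively, for $k\ge0$, $\widetilde\tau_{k+1}(\mathbf e_k)=\tau_{k+1}(\bar\omega_k)$, where for $k\ge1$ $\bar\omega_k\in\check\Omega$ is the pasted path with $\bar\omega_k(0-)=\omega_0(0-)$, $\bar\omega_k(t)=\omega_i(t-\widetilde\tau_i)$ for $\widetilde\tau_i\le t<\widetilde\tau_{i+1}$, $i\le k-1$, and $\bar\omega_k(t)=\omega_k(t-\widetilde\tau_k)$ for $t\ge\widetilde\tau_k$. On $\{\widetilde\tau_{k+1}<\infty\}$ let $\widetilde Z_{k+1}(\mathbf e_k)=Z_{k+1}(\bar\omega_k)$ and $\widetilde Y_{k+1}(\mathbf e_k)=\bar\omega_k(\widetilde\tau_{k+1}-)$; on $\{\widetilde\tau_{k+1}=\infty\}$ let them be $\bar z$ and $\bar e$. Let $Q_{k+1}(\mathbf e_k,\cdot)=Q_{(\widetilde Y_{k+1},\widetilde Z_{k+1})}$ if $\widetilde\tau_{k+1}(\mathbf e_k)<\infty$ and $\delta_{\bar e}$ otherwise,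 and $P_{k+1}(\mathbf e_k,\cdot)=\int_{\mathcal E}\mathbb P_v(\cdot)\,Q_{k+1}(\mathbf e_k,dv)$. $\widetilde{\mathbb P}_x$ is the probability measure on $(\widetilde\Omega,\widetilde{\mathcal G})$ with initial law $\check{\mathbb P}_x$ on $\Omega_0$ and successive transition kernels $P_1,P_2,\dots$ (Ionescu Tulcea). Put $\widetilde X(0-)=\omega_0(0-)$ and $\widetilde X(t)=X_k(t-\widetilde\tau_k)$ for $\widetilde\tau_k\le t<\widetilde\tau_{k+1}$, $k\ge0$. Then $\mathbb P_x^{(\tau,Z)}=\widetilde{\mathbb P}_x\widetilde X^{-1}$ is the law of $\widetilde X$ on $(\check\Omega,\check{\mathcal F})$; $x\mapsto\mathbb P_x^{(\tau,Z)}(F)$ is universally measurable for each $F\in\check{\mathcal F}$.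
   Formalization: As τ_k=∞ with probability in (0,1) breaks independence, it is proved for the cycles with τ_k<∞ a.s., and for cycles 0..n conditionally on {τ_n<∞}; cycles run in their own clock; the intervention times of the controlled process are assumed a.s. not to accumulate, so that its law exists. *)

theory Defs
  imports "HOL-Probability.Probability"
begin

section \<open>Path space\<close>

type_synonym 'e path = "real \<Rightarrow> 'e"

text \<open>An element of the augmented space is a pair whose first component is the value at \<open>0-\<close>.\<close>

type_synonym 'e aug = "'e \<times> 'e path"

text \<open>Time is \<open>[0,\<infinity>)\<close>; being extensional makes a path of type \<open>real \<Rightarrow> 'e\<close> determined by its
  values at nonnegative times.\<close>

definition cadlag :: "'e::polish_space path set" where
  "cadlag = {w \<in> extensional {0..}.
     (\<forall>t\<ge>0. (w \<longlongrightarrow> w t) (at_right t)) \<and> (\<forall>t>0. \<exists>l. (w \<longlongrightarrow> l) (at_left t))}"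

definition gen_by_times :: "real set \<Rightarrow> 'e::polish_space path measure" where
  "gen_by_times I = sigma cadlag {{w \<in> cadlag. w s \<in> B} | s B. s \<in> I \<and> B \<in> sets borel}"

definition path_F :: "'e::polish_space path measure" where
  "path_F = gen_by_times {0..}"

definition path_F_at :: "real \<Rightarrow> 'e::polish_space path measure" where
  "path_F_at t = gen_by_times {0..t}"

text \<open>The filtration of strict pasts. It is indexed by \<open>[0,\<infinity>]\<close> so that it can be combined with
  \<^const>\<open>stopping_time\<close> for \<open>[0,\<infinity>]\<close>-valued times; the extra index \<open>\<infinity>\<close> gives \<open>path_F\<close> and adds
  no condition. At \<open>0\<close> it is the trivial sigma-algebra.\<close>

definition path_F_minus :: "ennreal \<Rightarrow> 'e::polish_space path measure" where
  "path_F_minus t = gen_by_times {s. 0 \<le> s \<and> ennreal s < t}"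

definition aug_F :: "'e::polish_space aug measure" where
  "aug_F = borel \<Otimes>\<^sub>M path_F"

definition aug_F_minus :: "ennreal \<Rightarrow> 'e::polish_space aug measure" where
  "aug_F_minus t = borel \<Otimes>\<^sub>M path_F_minus t"

definition aug_left :: "'e::polish_space aug \<Rightarrow> real \<Rightarrow> 'e" where
  "aug_left w t = (if t = 0 then fst w else Lim (at_left t) (snd w))"

definition path_shift :: "real \<Rightarrow> 'e path \<Rightarrow> 'e path" where
  "path_shift r w = (\<lambda>s\<in>{0..}. w (r + s))"


section \<open>Markov families\<close>

definition universally_measurable :: "('e::polish_space \<Rightarrow> real) \<Rightarrow> bool" where
  "universally_measurable f \<longleftrightarrow>
     (\<forall>\<mu>. prob_space \<mu> \<and> sets \<mu> = sets borel \<longrightarrow> f \<in> borel_measurable (completion \<mu>))"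

text \<open>In the last clause \<open>g\<close> is a version of \<open>y \<mapsto> P\<^sub>x(X(s+t) \<in> B | X(s) = y)\<close>.\<close>

definition markov_family :: "('e::polish_space \<Rightarrow> 'e path measure) \<Rightarrow> bool" where
  "markov_family P \<longleftrightarrow>
     (\<forall>x. prob_space (P x) \<and> sets (P x) = sets path_F) \<and>
     (\<forall>A\<in>sets path_F. universally_measurable (\<lambda>x. measure (P x) A)) \<and>
     (\<forall>x. measure (P x) {w \<in> cadlag. w 0 = x} = 1) \<and>
     (\<forall>x. \<forall>s\<ge>0. \<forall>t\<ge>0. \<forall>B\<in>sets borel.
        AE w in P x.
          real_cond_exp (P x) (path_F_at s) (\<lambda>v. indicator B (v (s + t))) w =
          real_cond_exp (P x) (vimage_algebra cadlag (\<lambda>v. v s) borel)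
            (\<lambda>v. indicator B (v (s + t))) w) \<and>
     (\<forall>x. \<forall>s\<ge>0. \<forall>t\<ge>0. \<forall>B\<in>sets borel. \<exists>g\<in>borel_measurable borel.
        (AE w in P x.
          real_cond_exp (P x) (vimage_algebra cadlag (\<lambda>v. v s) borel)
            (\<lambda>v. indicator B (v (s + t))) w = g (w s)) \<and>
        (AE y in distr (P x) borel (\<lambda>w. w s).
          g y = measure (P y) {w \<in> cadlag. w t \<in> B}))"


section \<open>Impulse policies\<close>

definition past_before ::
    "(ennreal \<Rightarrow> 'e::polish_space path measure) \<Rightarrow> ('e path \<Rightarrow> ennreal) \<Rightarrow> 'e path measure" where
  "past_before G \<eta> =
     sigma cadlag {{w \<in> A. t < \<eta> w} | A t. t < \<infinity> \<and> A \<in> sets (G t)}"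

text \<open>For a time \<open>\<eta>\<close> that does not depend on the value at \<open>0-\<close> this is
  \<open>borel \<Otimes>\<^sub>M past_before path_F_minus \<eta>\<close>. The present form also makes sense when \<open>\<eta>\<close> does
  depend on that value, as the first intervention time may.\<close>

definition aug_past_before :: "('e::polish_space aug \<Rightarrow> ennreal) \<Rightarrow> 'e aug measure" where
  "aug_past_before \<eta> =
     sigma (UNIV \<times> cadlag)
       ({\<Gamma> \<times> cadlag | \<Gamma>. \<Gamma> \<in> sets borel} \<union>
        {{w \<in> A. t < \<eta> w} | A t. t < \<infinity> \<and> A \<in> sets (aug_F_minus t)})"

text \<open>The policy is indexed so that \<open>\<tau> 0 = 0\<close>; \<open>Z 0\<close> is irrelevant. The clause for \<open>\<tau> k w = \<infinity>\<close>
  is what makes \<open>[\<tau> k, \<tau> (k + 1))\<close>, \<open>k \<ge> 0\<close>, a partition of \<open>[0,\<infinity>)\<close> when some intervention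
  never happens.\<close>

definition nominal_impulse_policy ::
    "'z measure \<Rightarrow> (nat \<Rightarrow> 'e::polish_space aug \<Rightarrow> ennreal) \<Rightarrow> (nat \<Rightarrow> 'e aug \<Rightarrow> 'z) \<Rightarrow> bool" where
  "nominal_impulse_policy MZ \<tau> Z \<longleftrightarrow>
     (\<forall>w\<in>space aug_F. \<tau> 0 w = 0) \<and>
     stopping_time aug_F_minus (\<tau> 1) \<and>
     Z 1 \<in> aug_past_before (\<tau> 1) \<rightarrow>\<^sub>M MZ \<and>
     (\<forall>k\<ge>2. \<exists>T \<zeta>. stopping_time path_F_minus T \<and> \<zeta> \<in> past_before path_F_minus T \<rightarrow>\<^sub>M MZ \<and>
        (\<forall>w\<in>space aug_F. \<tau> k w = T (snd w) \<and> Z k w = \<zeta> (snd w))) \<and>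
     (\<forall>k\<ge>1. \<forall>w\<in>space aug_F.
        (\<tau> k w < \<infinity> \<longrightarrow> \<tau> k w < \<tau> (Suc k) w) \<and> (\<tau> k w = \<infinity> \<longrightarrow> \<tau> (Suc k) w = \<infinity>)) \<and>
     (\<forall>w\<in>space aug_F. (\<lambda>k. \<tau> k w) \<longlonglongrightarrow> \<infinity>)"

definition independent_cycles_policy ::
    "'z measure \<Rightarrow> ('e::polish_space \<times> 'z \<Rightarrow> 'e measure) \<Rightarrow>
     (nat \<Rightarrow> 'e aug \<Rightarrow> ennreal) \<Rightarrow> (nat \<Rightarrow> 'e aug \<Rightarrow> 'z) \<Rightarrow> bool" where
  "independent_cycles_policy MZ Q \<tau> Z \<longleftrightarrow>
     nominal_impulse_policy MZ \<tau> Z \<and>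
     (\<exists>\<sigma>\<in>borel_measurable aug_F. \<forall>w\<in>space aug_F. \<tau> 1 w = \<tau> 0 w + \<sigma> w) \<and>
     (\<forall>k\<ge>2. \<exists>\<sigma>\<in>borel_measurable path_F. \<forall>w\<in>space aug_F. \<tau> (k - 1) w < \<infinity> \<longrightarrow>
        \<tau> k w = \<tau> (k - 1) w + \<sigma> (path_shift (enn2real (\<tau> (k - 1) w)) (snd w))) \<and>
     (\<forall>k\<ge>1. \<forall>w\<in>space aug_F. \<forall>w'\<in>space aug_F. \<tau> k w < \<infinity> \<longrightarrow> \<tau> k w' < \<infinity> \<longrightarrow>
        Q (aug_left w (enn2real (\<tau> k w)), Z k w) = Q (aug_left w' (enn2real (\<tau> k w')), Z k w'))"


section \<open>The controlled process\<close>

text \<open>The product \<open>(E \<times> \<Omega>) \<times> \<Omega> \<times> \<Omega> \<times> \<dots>\<close> is bracketed as \<open>E \<times> (\<Omega> \<times> \<Omega> \<times> \<dots>)\<close>: an element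
  \<open>(y, u)\<close> has zeroth component \<open>(y, u 0)\<close> and \<open>k\<close>-th component \<open>u k\<close> for \<open>k \<ge> 1\<close>.\<close>

type_synonym 'e pieces = "'e \<times> (nat \<Rightarrow> 'e path)"

definition pieces_G :: "'e::polish_space pieces measure" where
  "pieces_G = borel \<Otimes>\<^sub>M PiM UNIV (\<lambda>_. path_F)"

text \<open>\<open>pasted \<tau> e k\<close> depends only on the components \<open>0, \<dots>, k\<close> of \<open>e\<close>: each step replaces the tail
  of the previous path, from the next intervention time on, by the next component. The
  closed form on each cycle is \<open>pasted_segment\<close> below.\<close>

primrec pasted :: "(nat \<Rightarrow> 'e aug \<Rightarrow> ennreal) \<Rightarrow> 'e pieces \<Rightarrow> nat \<Rightarrow> 'e aug" where
  "pasted \<tau> e 0 = (fst e, snd e 0)"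
| "pasted \<tau> e (Suc k) =
     (let T = \<tau> (Suc k) (pasted \<tau> e k) in
      (fst e, \<lambda>t\<in>{0..}. if ennreal t < T then snd (pasted \<tau> e k) t
                        else snd e (Suc k) (t - enn2real T)))"

definition pieces_time :: "(nat \<Rightarrow> 'e aug \<Rightarrow> ennreal) \<Rightarrow> nat \<Rightarrow> 'e pieces \<Rightarrow> ennreal" where
  "pieces_time \<tau> k e = (case k of 0 \<Rightarrow> 0 | Suc j \<Rightarrow> \<tau> (Suc j) (pasted \<tau> e j))"

lemma pasted_segment:
  assumes "\<And>j. j < k \<Longrightarrow> pieces_time \<tau> j e \<le> pieces_time \<tau> (Suc j) e"
    and "i \<le> k" "0 \<le> t" "pieces_time \<tau> i e \<le> ennreal t"
    and "i < k \<Longrightarrow> ennreal t < pieces_time \<tau> (Suc i) e"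
  shows "snd (pasted \<tau> e k) t = snd e i (t - enn2real (pieces_time \<tau> i e))"
  using assms
proof (induction k)
  case 0
  then show ?case by (simp add: pieces_time_def)
next
  case (Suc k)
  show ?case
  proof (cases "i = Suc k")
    case True
    then show ?thesis using Suc.prems
      by (auto simp: pieces_time_def Let_def dest: leD)
  next
    case False
    have le: "pieces_time \<tau> (Suc i) e \<le> pieces_time \<tau> (Suc k) e"
    proof -
      have "n \<le> Suc k \<Longrightarrow> pieces_time \<tau> (Suc i) e \<le> pieces_time \<tau> n e" if "Suc i \<le> n" for n
        using that
      proof (induction n rule: dec_induct)
        case (step n)
        then show ?case using Suc.prems(1)[of n] by (auto intro: order_trans)
      qed simp
      then show ?thesis using False Suc.prems(2) by simp
    qed
    have "ennreal t < pieces_time \<tau> (Suc k) e"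
      using False Suc.prems le by (auto intro: less_le_trans)
    then have "snd (pasted \<tau> e (Suc k)) t = snd (pasted \<tau> e k) t"
      using Suc.prems by (simp add: pieces_time_def Let_def)
    also have "\<dots> = snd e i (t - enn2real (pieces_time \<tau> i e))"
      using Suc.IH Suc.prems False by simp
    finally show ?thesis .
  qed
qed

definition pieces_state ::
    "'e \<Rightarrow> (nat \<Rightarrow> 'e::polish_space aug \<Rightarrow> ennreal) \<Rightarrow> nat \<Rightarrow> 'e pieces \<Rightarrow> 'e" where
  "pieces_state ebar \<tau> k e =
     (if pieces_time \<tau> (Suc k) e < \<infinity>
      then aug_left (pasted \<tau> e k) (enn2real (pieces_time \<tau> (Suc k) e)) else ebar)"

definition pieces_impulse ::
    "'z \<Rightarrow> (nat \<Rightarrow> 'e aug \<Rightarrow> ennreal) \<Rightarrow> (nat \<Rightarrow> 'e aug \<Rightarrow> 'z) \<Rightarrow> nat \<Rightarrow> 'e pieces \<Rightarrow> 'z" where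
  "pieces_impulse zbar \<tau> Z k e =
     (if pieces_time \<tau> (Suc k) e < \<infinity> then Z (Suc k) (pasted \<tau> e k) else zbar)"

definition restart_law ::
    "('e::polish_space \<times> 'z \<Rightarrow> 'e measure) \<Rightarrow> 'e \<Rightarrow> 'z \<Rightarrow>
     (nat \<Rightarrow> 'e aug \<Rightarrow> ennreal) \<Rightarrow> (nat \<Rightarrow> 'e aug \<Rightarrow> 'z) \<Rightarrow> nat \<Rightarrow> 'e pieces \<Rightarrow> 'e measure" where
  "restart_law Q ebar zbar \<tau> Z k e =
     (if pieces_time \<tau> (Suc k) e < \<infinity>
      then Q (pieces_state ebar \<tau> k e, pieces_impulse zbar \<tau> Z k e) else return borel ebar)"

text \<open>The measure \<open>A \<mapsto> \<integral> K v A \<mu>(dv)\<close> on the sigma-algebra of \<open>N\<close>. The function \<open>v \<mapsto> K v A\<close> need only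
  be universally measurable, hence the completion; \<^const>\<open>bind\<close> would require Borel
  measurability.\<close>

definition mixture :: "'b measure \<Rightarrow> 'a measure \<Rightarrow> ('a \<Rightarrow> 'b measure) \<Rightarrow> 'b measure" where
  "mixture N \<mu> K = measure_of (space N) (sets N) (\<lambda>A. \<integral>\<^sup>+ v. emeasure (K v) A \<partial>completion \<mu>)"

definition transition ::
    "('e::polish_space \<Rightarrow> 'e path measure) \<Rightarrow> ('e \<times> 'z \<Rightarrow> 'e measure) \<Rightarrow> 'e \<Rightarrow> 'z \<Rightarrow>
     (nat \<Rightarrow> 'e aug \<Rightarrow> ennreal) \<Rightarrow> (nat \<Rightarrow> 'e aug \<Rightarrow> 'z) \<Rightarrow> nat \<Rightarrow> 'e pieces \<Rightarrow> 'e path measure" where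
  "transition P Q ebar zbar \<tau> Z k e = mixture path_F (restart_law Q ebar zbar \<tau> Z k e) P"

definition aug_P :: "('e::polish_space \<Rightarrow> 'e path measure) \<Rightarrow> 'e \<Rightarrow> 'e aug measure" where
  "aug_P P x = return borel x \<Otimes>\<^sub>M P x"

text \<open>The measure with a given initial law and given successive kernels \<open>K k\<close> from the components
  \<open>0, \<dots>, k\<close> to component \<open>k + 1\<close>. The locale \<^locale>\<open>Ionescu_Tulcea\<close> asks for Borel measurable
  kernels; \<^const>\<open>transition\<close> is in general only universally measurable, so the measure is
  given by properties that determine it uniquely.\<close>

definition has_transitions ::
    "'e::polish_space aug measure \<Rightarrow> (nat \<Rightarrow> 'e pieces \<Rightarrow> 'e path measure) \<Rightarrow>
     'e pieces measure \<Rightarrow> bool" where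
  "has_transitions I K M \<longleftrightarrow>
     prob_space M \<and> sets M = sets pieces_G \<and>
     distr M aug_F (\<lambda>e. (fst e, snd e 0)) = I \<and>
     (\<forall>k. \<forall>A\<in>sets (borel \<Otimes>\<^sub>M PiM {..k} (\<lambda>_. path_F)). \<forall>B\<in>sets path_F.
        emeasure M {e \<in> space M. (fst e, restrict (snd e) {..k}) \<in> A \<and> snd e (Suc k) \<in> B} =
        (\<integral>\<^sup>+ e. indicator A (fst e, restrict (snd e) {..k}) * emeasure (K k e) B \<partial>completion M))"

definition pieces_P ::
    "('e::polish_space \<Rightarrow> 'e path measure) \<Rightarrow> ('e \<times> 'z \<Rightarrow> 'e measure) \<Rightarrow> 'e \<Rightarrow> 'z \<Rightarrow>
     (nat \<Rightarrow> 'e aug \<Rightarrow> ennreal) \<Rightarrow> (nat \<Rightarrow> 'e aug \<Rightarrow> 'z) \<Rightarrow> 'e \<Rightarrow> 'e pieces measure" where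
  "pieces_P P Q ebar zbar \<tau> Z x =
     (THE M. has_transitions (aug_P P x) (transition P Q ebar zbar \<tau> Z) M)"

text \<open>If the intervention times accumulate, the pieces do not define a path on all of \<open>[0,\<infinity>)\<close>;
  on that event a constant path is used as a dummy value.\<close>

definition controlled :: "'e \<Rightarrow> (nat \<Rightarrow> 'e aug \<Rightarrow> ennreal) \<Rightarrow> 'e pieces \<Rightarrow> 'e aug" where
  "controlled ebar \<tau> e =
     (fst e, \<lambda>t\<in>{0..}.
        if (\<lambda>k. pieces_time \<tau> k e) \<longlonglongrightarrow> \<infinity>
        then (let k = (THE k. pieces_time \<tau> k e \<le> ennreal t \<and> ennreal t < pieces_time \<tau> (Suc k) e)
              in snd e k (t - enn2real (pieces_time \<tau> k e)))
        else ebar)"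

definition controlled_P ::
    "('e::polish_space \<Rightarrow> 'e path measure) \<Rightarrow> ('e \<times> 'z \<Rightarrow> 'e measure) \<Rightarrow> 'e \<Rightarrow> 'z \<Rightarrow>
     (nat \<Rightarrow> 'e aug \<Rightarrow> ennreal) \<Rightarrow> (nat \<Rightarrow> 'e aug \<Rightarrow> 'z) \<Rightarrow> 'e \<Rightarrow> 'e aug measure" where
  "controlled_P P Q ebar zbar \<tau> Z x =
     distr (pieces_P P Q ebar zbar \<tau> Z x) aug_F (controlled ebar \<tau>)"

text \<open>The law on the augmented space is defined only if the controlled process is almost surely
  a path on all of \<open>[0,\<infinity>)\<close>. This does not follow from the condition \<open>\<tau> k w \<longlonglongrightarrow> \<infinity>\<close> on cadlag
  paths \<open>w\<close>, since pieces on accumulating intervals need not have a left limit at the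
  accumulation point.\<close>

definition nonaccumulating ::
    "('e::polish_space \<Rightarrow> 'e path measure) \<Rightarrow> ('e \<times> 'z \<Rightarrow> 'e measure) \<Rightarrow> 'e \<Rightarrow> 'z \<Rightarrow>
     (nat \<Rightarrow> 'e aug \<Rightarrow> ennreal) \<Rightarrow> (nat \<Rightarrow> 'e aug \<Rightarrow> 'z) \<Rightarrow> bool" where
  "nonaccumulating P Q ebar zbar \<tau> Z \<longleftrightarrow>
     (\<forall>x. AE e in pieces_P P Q ebar zbar \<tau> Z x. (\<lambda>k. pieces_time \<tau> k e) \<longlonglongrightarrow> \<infinity>)"

definition controlled_P_init ::
    "('e::polish_space \<Rightarrow> 'e path measure) \<Rightarrow> ('e \<times> 'z \<Rightarrow> 'e measure) \<Rightarrow> 'e \<Rightarrow> 'z \<Rightarrow>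
     (nat \<Rightarrow> 'e aug \<Rightarrow> ennreal) \<Rightarrow> (nat \<Rightarrow> 'e aug \<Rightarrow> 'z) \<Rightarrow> 'e measure \<Rightarrow> 'e aug measure" where
  "controlled_P_init P Q ebar zbar \<tau> Z \<nu> = mixture aug_F \<nu> (controlled_P P Q ebar zbar \<tau> Z)"


section \<open>Cycles\<close>

text \<open>The cycle \<open>{X(t) : \<tau> k \<le> t < \<tau> (k + 1)}\<close> as a process with random lifetime in its own clock
  \<open>s = t - \<tau> k\<close>, equal to \<open>None\<close> from the end of the cycle on. It is \<open>None\<close> throughout when
  \<open>\<tau> k = \<infinity>\<close>. The clock has to be reset for independence: in absolute time the beginning of
  a cycle is the end of the one before.\<close>

definition cycle_process :: "(nat \<Rightarrow> 'e aug \<Rightarrow> ennreal) \<Rightarrow> nat \<Rightarrow> 'e aug \<Rightarrow> real \<Rightarrow> 'e option" where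
  "cycle_process \<tau> k w = (\<lambda>s\<in>{0..}. if \<tau> k w + ennreal s < \<tau> (Suc k) w
                            then Some (snd w (enn2real (\<tau> k w) + s)) else None)"

definition option_borel :: "'e::polish_space option measure" where
  "option_borel = sigma UNIV {Some ` B | B. B \<in> sets borel}"

definition cycle_space :: "(real \<Rightarrow> 'e::polish_space option) measure" where
  "cycle_space = PiM {0..} (\<lambda>_. option_borel)"

end

theory Submission
  imports Defs
begin

text \<open>Condition (b) turns the restart law after the \<open>k\<close>-th intervention into a constant, so the
  transition kernels take two values only: the law of a fresh piece if the next intervention
  happens, and a dummy law otherwise. Hence the law on the pieces is the image of the product of
  the initial law with those of independent pairs (fresh piece, dummy piece) under the map
  that switches to the dummy pieces once an intervention fails to happen. Since intervention times
  are stopping times of the strict past, Galmarini's test shows that they take the same values on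
  the controlled path as on the pasted paths, and condition (a) turns each cycle that begins into a function of its own
  piece. The event that the \<open>n\<close>-th intervention happens and that the cycles \<open>0, \<dots>, n\<close> lie in given
  sets is therefore a product event, which gives independence conditionally on the \<open>n\<close>-th
  intervention. Completing \<open>\<nu>\<close> makes \<open>x \<mapsto> P\<^sub>x\<close> a measurable kernel, so that mixtures become
  monadic binds.\<close>

section \<open>Path space\<close>

text \<open>A cycle that never ends leaves all later cycles empty. If the k-th intervention, k \<ge>
  1, fails with a probability strictly between 0 and 1, its failure can be read both from cycle k
  and from the cycles before it, so these cannot be independent. Hence the two forms of the
  conclusion: conditioning on an intervention, or cycles that begin almost surely. Conditioning
  keeps the product form because the event that the n-th intervention happens says exactly that each
  cycle before the n-th has finite length, one condition per cycle; the n-th itself may last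
  forever. The kernels prescribe a different law after a failure, so the pieces as a family need not
  be independent. But dummy pieces never enter a path, so all times can be computed from fresh
  pieces alone and one infinite product carries the whole construction. As the law of the pieces is
  given by a definite description, the explicit image measure must also be shown to be the only one
  with this initial law and these kernels.\<close>

lemma space_gen_by_times [simp]: "space (gen_by_times I) = cadlag"
  by (simp add: gen_by_times_def space_measure_of_conv)

lemma sets_gen_by_times:
  "sets (gen_by_times I :: 'e::polish_space path measure) =
     sigma_sets cadlag {{w \<in> cadlag. w s \<in> B} | s B. s \<in> I \<and> B \<in> sets (borel :: 'e measure)}"
  unfolding gen_by_times_def by (rule sets_measure_of) auto

lemma space_path_F [simp]: "space path_F = cadlag"
  by (simp add: path_F_def)

lemma space_path_F_minus [simp]: "space (path_F_minus t) = cadlag"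
  by (simp add: path_F_minus_def)

lemma cadlag_in_sets [simp]: "cadlag \<in> sets path_F"
  using sets.top[of path_F] by simp

lemma space_aug_F: "space (aug_F :: 'e::polish_space aug measure) = UNIV \<times> cadlag"
  by (simp add: aug_F_def space_pair_measure)

lemma space_aug_F_minus: "space (aug_F_minus t :: 'e::polish_space aug measure) = UNIV \<times> cadlag"
  by (simp add: aug_F_minus_def space_pair_measure)

lemma space_pieces_G: "space (pieces_G :: 'e::polish_space pieces measure) = UNIV \<times> (UNIV \<rightarrow> cadlag)"
  by (simp add: pieces_G_def space_pair_measure space_PiM PiE_UNIV_domain)

lemma sets_path_F_minus_subset: "sets (path_F_minus t) \<subseteq> sets path_F"
  unfolding path_F_minus_def path_F_def sets_gen_by_times by (rule sigma_sets_mono') auto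

text \<open>The identity map into the smaller product is measurable because both of its components
  are; its preimages give the inclusion.\<close>

lemma sets_aug_F_minus_subset: "sets (aug_F_minus t) \<subseteq> sets aug_F"
proof -
  have "id \<in> aug_F \<rightarrow>\<^sub>M (aug_F_minus t :: 'a aug measure)"
    unfolding aug_F_minus_def
  proof (rule measurable_pair)
    have "id \<in> path_F \<rightarrow>\<^sub>M (path_F_minus t :: 'a path measure)"
      by (intro measurableI) (auto dest!: subsetD[OF sets_path_F_minus_subset] intro: sets.Int_space_eq2[THEN ssubst]
          simp flip: space_path_F)
    then have "(\<lambda>w. id (snd w)) \<in> aug_F \<rightarrow>\<^sub>M (path_F_minus t :: 'a path measure)"
      unfolding aug_F_def by (rule measurable_compose[OF measurable_snd])
    then show "snd \<circ> id \<in> aug_F \<rightarrow>\<^sub>M (path_F_minus t :: 'a path measure)"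
      by (simp add: comp_def)
    show "fst \<circ> id \<in> aug_F \<rightarrow>\<^sub>M (borel :: 'a measure)"
      by (simp add: aug_F_def)
  qed
  note * = measurable_sets[OF this]
  show ?thesis
  proof
    fix A :: "'a aug set" assume A: "A \<in> sets (aug_F_minus t)"
    then have "A \<subseteq> space aug_F"
      using sets.sets_into_space[OF A] by (simp add: space_aug_F space_aug_F_minus)
    then show "A \<in> sets aug_F" using *[OF A] by (simp add: Int_absorb2)
  qed
qed

lemma measurable_path_FI:
  assumes "\<And>x. x \<in> space N \<Longrightarrow> f x \<in> cadlag"
    and "\<And>s. 0 \<le> s \<Longrightarrow> (\<lambda>x. f x s) \<in> borel_measurable N"
  shows "f \<in> N \<rightarrow>\<^sub>M path_F"
  unfolding path_F_def gen_by_times_def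
proof (rule measurable_measure_of)
  fix y :: "'b path set"
  assume "y \<in> {{w \<in> cadlag. w s \<in> B} | s B. s \<in> {0..} \<and> B \<in> sets borel}"
  then obtain s B where y: "y = {w \<in> cadlag. w s \<in> B}" "0 \<le> s" "B \<in> sets borel" by auto
  have "f -` y \<inter> space N = (\<lambda>x. f x s) -` B \<inter> space N"
    using assms(1) y by auto
  then show "f -` y \<inter> space N \<in> sets N"
    using measurable_sets[OF assms(2)] y by simp
qed (use assms(1) in auto)

lemma measurable_path_value:
  assumes "0 \<le> s"
  shows "(\<lambda>w. w s) \<in> borel_measurable path_F"
proof (rule measurableI)
  fix B :: "'a set" assume "B \<in> sets borel"
  then have "{w \<in> cadlag. w s \<in> B} \<in> sets path_F"
    unfolding path_F_def sets_gen_by_times using assms by (intro sigma_sets.Basic) auto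
  also have "{w \<in> cadlag. w s \<in> B} = (\<lambda>w. w s) -` B \<inter> space path_F" by auto
  finally show "(\<lambda>w. w s) -` B \<inter> space path_F \<in> sets path_F" .
qed auto

lemma cadlag_extensional: "w \<in> cadlag \<Longrightarrow> w \<in> extensional {0..}"
  by (simp add: cadlag_def)

lemma cadlag_undefined: "w \<in> cadlag \<Longrightarrow> s < 0 \<Longrightarrow> w s = undefined"
  using extensional_arb[OF cadlag_extensional, of w s] by simp

lemma cadlag_right_continuous: "w \<in> cadlag \<Longrightarrow> 0 \<le> t \<Longrightarrow> (w \<longlongrightarrow> w t) (at_right t)"
  by (simp add: cadlag_def)

lemma cadlag_left_limit: "w \<in> cadlag \<Longrightarrow> 0 < t \<Longrightarrow> \<exists>l. (w \<longlongrightarrow> l) (at_left t)"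
  by (simp add: cadlag_def)

lemma measurable_path_eval:
  assumes f: "f \<in> N \<rightarrow>\<^sub>M path_F" and g: "g \<in> borel_measurable N"
  shows "(\<lambda>x. f x (g x)) \<in> borel_measurable N"
proof -
  \<comment> \<open>\<open>h n x\<close> tends to \<open>g x\<close> strictly from the right and takes countably many values.\<close>
  define h where "h n x = (real_of_int \<lfloor>real (Suc n) * max 0 (g x)\<rfloor> + 1) / real (Suc n)" for n x
  have h_gt: "max 0 (g x) < h n x" and h_le: "h n x \<le> max 0 (g x) + 1 / real (Suc n)" for n x
  proof -
    have "real (Suc n) * max 0 (g x) < real_of_int \<lfloor>real (Suc n) * max 0 (g x)\<rfloor> + 1" by linarith
    then show "max 0 (g x) < h n x" unfolding h_def
      by (subst pos_less_divide_eq) (simp_all del: of_nat_Suc add: mult.commute)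
    have "real_of_int \<lfloor>real (Suc n) * max 0 (g x)\<rfloor> + 1 \<le> real (Suc n) * max 0 (g x) + 1" by linarith
    then have "h n x \<le> (real (Suc n) * max 0 (g x) + 1) / real (Suc n)"
      unfolding h_def by (rule divide_right_mono) simp
    then show "h n x \<le> max 0 (g x) + 1 / real (Suc n)" by (simp add: add_divide_distrib)
  qed
  have "(\<lambda>x. f x (max 0 (g x))) \<in> borel_measurable N"
  proof (rule borel_measurable_LIMSEQ_metric)
    fix n
    \<comment> \<open>The index \<open>i\<close> runs over all integers, so \<open>max 0\<close>
      keeps the evaluation time nonnegative. At the index actually taken it changes nothing, as
      \<open>h n x\<close> is positive.\<close>
    have "(\<lambda>x. f x (max 0 ((real_of_int i + 1) / real (Suc n)))) \<in> borel_measurable N" for i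
      by (rule measurable_compose[OF f measurable_path_value]) simp
    then have "(\<lambda>x. f x (max 0 ((real_of_int \<lfloor>real (Suc n) * max 0 (g x)\<rfloor> + 1) / real (Suc n))))
        \<in> borel_measurable N"
      by (rule measurable_compose_countable) (use g in measurable)
    moreover have "max 0 (h n x) = h n x" for x using h_gt[of x n] by linarith
    ultimately show "(\<lambda>x. f x (h n x)) \<in> borel_measurable N" by (simp add: h_def)
  next
    fix x assume x: "x \<in> space N"
    have "(\<lambda>n. h n x) \<longlonglongrightarrow> max 0 (g x)"
    proof (rule tendsto_sandwich[of "\<lambda>_. max 0 (g x)"])
      show "(\<lambda>n. max 0 (g x) + 1 / real (Suc n)) \<longlonglongrightarrow> max 0 (g x)"
        using tendsto_add[OF tendsto_const LIMSEQ_Suc[OF lim_inverse_n']] by fastforce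
    qed (use h_gt h_le in \<open>auto intro!: always_eventually less_imp_le simp del: of_nat_Suc\<close>)
    then have "filterlim (\<lambda>n. h n x) (at_right (max 0 (g x))) sequentially"
      by (rule tendsto_imp_filterlim_at_right) (use h_gt in \<open>blast intro: always_eventually\<close>)
    moreover have "(f x \<longlongrightarrow> f x (max 0 (g x))) (at_right (max 0 (g x)))"
      using measurable_space[OF f x] by (intro cadlag_right_continuous) auto
    ultimately show "(\<lambda>n. f x (h n x)) \<longlonglongrightarrow> f x (max 0 (g x))"
      by (rule filterlim_compose[rotated])
  qed
  \<comment> \<open>At negative times every path has the value \<open>undefined\<close>.\<close>
  then have "(\<lambda>x. if g x < 0 then undefined else f x (max 0 (g x))) \<in> borel_measurable N"
    using g by measurable
  then show ?thesis
    using measurable_space[OF f] by (subst measurable_cong) (auto simp: cadlag_undefined)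
qed

section \<open>Local criterion and pasting for cadlag paths\<close>

text \<open>Tailored to the controlled path, which up to any given time agrees with some pasted
  path. Agreement must reach strictly beyond \<open>t\<close> to cover the right limit.\<close>

lemma cadlag_local:
  assumes "w \<in> extensional {0..}"
    and loc: "\<And>t. 0 \<le> t \<Longrightarrow> \<exists>v\<in>cadlag. \<exists>r>t. \<forall>s. 0 \<le> s \<longrightarrow> s < r \<longrightarrow> w s = v s"
  shows "w \<in> cadlag"
  unfolding cadlag_def
proof (intro CollectI conjI allI impI)
  fix t :: real assume t: "0 \<le> t"
  then obtain v r where v: "v \<in> cadlag" "r > t" "\<And>s. 0 \<le> s \<Longrightarrow> s < r \<Longrightarrow> w s = v s" using loc by blast
  have "\<forall>\<^sub>F s in at_right t. v s = w s"
    unfolding eventually_at_right_field using v t by (intro exI[of _ r]) auto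
  from Lim_transform_eventually[OF cadlag_right_continuous[OF v(1) t] this]
  show "(w \<longlongrightarrow> w t) (at_right t)" using v t by simp
next
  fix t :: real assume t: "0 < t"
  then obtain v r where v: "v \<in> cadlag" "r > t" "\<And>s. 0 \<le> s \<Longrightarrow> s < r \<Longrightarrow> w s = v s"
    using loc[of t] by auto
  have "\<forall>\<^sub>F s in at_left t. v s = w s"
    unfolding eventually_at_left_field using v t by (intro exI[of _ 0]) auto
  moreover obtain l where "(v \<longlongrightarrow> l) (at_left t)"
    using cadlag_left_limit[OF v(1) t] by auto
  ultimately have "(w \<longlongrightarrow> l) (at_left t)" by (rule Lim_transform_eventually[rotated])
  then show "\<exists>l. (w \<longlongrightarrow> l) (at_left t)" by (rule exI)
qed fact

lemma cadlag_const: "(\<lambda>t\<in>{0..}. c) \<in> cadlag"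
  unfolding cadlag_def
proof (intro CollectI conjI allI impI)
  fix t :: real assume t: "0 \<le> t"
  have "\<forall>\<^sub>F s in at_right t. (\<lambda>t\<in>{0..}. c) s = (\<lambda>t\<in>{0..}. c) t"
    unfolding eventually_at_right_field using t by (intro exI[of _ "t + 1"]) auto
  then show "((\<lambda>t\<in>{0..}. c) \<longlongrightarrow> (\<lambda>t\<in>{0..}. c) t) (at_right t)"
    by (rule tendsto_eventually)
next
  fix t :: real assume t: "0 < t"
  have "\<forall>\<^sub>F s in at_left t. (\<lambda>t\<in>{0..}. c) s = c"
    unfolding eventually_at_left_field using t by (intro exI[of _ 0]) auto
  then have "((\<lambda>t\<in>{0..}. c) \<longlongrightarrow> c) (at_left t)" by (rule tendsto_eventually)
  then show "\<exists>l. ((\<lambda>t\<in>{0..}. c) \<longlongrightarrow> l) (at_left t)" by (rule exI)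
qed auto

text \<open>At the junction \<open>r\<close> right continuity comes from \<open>v\<close> and the
  left limit from \<open>w\<close>; hence the split at \<open>t < r\<close> for the former and at
  \<open>t \<le> r\<close> for the latter.\<close>

lemma cadlag_paste:
  assumes w: "w \<in> cadlag" and v: "v \<in> cadlag"
  shows "(\<lambda>t\<in>{0..}. if ennreal t < T then w t else v (t - enn2real T)) \<in> cadlag" (is "?p \<in> _")
proof (cases T)
  case top
  then have "?p = w" using extensional_restrict[OF cadlag_extensional[OF w]] by (simp add: less_top)
  then show ?thesis using w by simp
next
  case (real r)
  have p: "?p = (\<lambda>t\<in>{0..}. if t < r then w t else v (t - r))"
    using real by (auto simp: ennreal_less_iff intro!: restrict_ext)
  have shift_right: "filterlim (\<lambda>s. s - r) (at_right (t - r)) (at_right t)" for t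
    by (auto simp: filterlim_at eventually_at_filter intro!: tendsto_eq_intros)
  have shift_left: "filterlim (\<lambda>s. s - r) (at_left (t - r)) (at_left t)" for t
    by (auto simp: filterlim_at eventually_at_filter intro!: tendsto_eq_intros)
  show ?thesis unfolding p cadlag_def
  proof (intro CollectI conjI allI impI)
    fix t :: real assume t: "0 \<le> t"
    show "((\<lambda>t\<in>{0..}. if t < r then w t else v (t - r)) \<longlongrightarrow>
        (\<lambda>t\<in>{0..}. if t < r then w t else v (t - r)) t) (at_right t)" (is "(?q \<longlongrightarrow> _) _")
    proof (cases "t < r")
      case True
      have "\<forall>\<^sub>F s in at_right t. w s = ?q s"
        unfolding eventually_at_right_field using t True by (intro exI[of _ r]) auto
      from Lim_transform_eventually[OF cadlag_right_continuous[OF w t] this]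
      show ?thesis using t True by (simp add: restrict_def)
    next
      case False
      have "\<forall>\<^sub>F s in at_right t. v (s - r) = ?q s"
        unfolding eventually_at_right_field using t False by (intro exI[of _ "t + 1"]) auto
      moreover have "((\<lambda>s. v (s - r)) \<longlongrightarrow> v (t - r)) (at_right t)"
        using False by (intro filterlim_compose[OF cadlag_right_continuous[OF v] shift_right]) auto
      ultimately have "(?q \<longlongrightarrow> v (t - r)) (at_right t)" by (rule Lim_transform_eventually[rotated])
      then show ?thesis using t False by (simp add: restrict_def)
    qed
  next
    fix t :: real assume t: "0 < t"
    show "\<exists>l. ((\<lambda>t\<in>{0..}. if t < r then w t else v (t - r)) \<longlongrightarrow> l) (at_left t)"
      (is "\<exists>l. (?q \<longlongrightarrow> l) _")
    proof (cases "t \<le> r")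
      case True
      have "\<forall>\<^sub>F s in at_left t. w s = ?q s"
        unfolding eventually_at_left_field using t True by (intro exI[of _ 0]) auto
      moreover obtain l where "(w \<longlongrightarrow> l) (at_left t)"
        using cadlag_left_limit[OF w t] by auto
      ultimately have "(?q \<longlongrightarrow> l) (at_left t)" by (rule Lim_transform_eventually[rotated])
      then show ?thesis by (rule exI)
    next
      case False
      have "\<forall>\<^sub>F s in at_left t. v (s - r) = ?q s"
        unfolding eventually_at_left_field using t False real by (intro exI[of _ r]) auto
      moreover obtain l where "(v \<longlongrightarrow> l) (at_left (t - r))" using cadlag_left_limit[OF v, of "t - r"] False by auto
      then have "((\<lambda>s. v (s - r)) \<longlongrightarrow> l) (at_left t)"
        by (rule filterlim_compose[OF _ shift_left])
      ultimately have "(?q \<longlongrightarrow> l) (at_left t)" by (rule Lim_transform_eventually[rotated])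
      then show ?thesis by (rule exI)
    qed
  qed auto
qed

section \<open>Strict pasts and stopping times see only part of a path\<close>

text \<open>The sets that do not separate \<open>w\<close> from \<open>w'\<close> form a
  sigma-algebra, so only the generators need to be checked.\<close>

lemma gen_by_times_local:
  assumes "A \<in> sets (gen_by_times I)" and "w \<in> cadlag" "w' \<in> cadlag"
    and eq: "\<And>s. s \<in> I \<Longrightarrow> w s = w' s"
  shows "w \<in> A \<longleftrightarrow> w' \<in> A"
  using assms(1) unfolding sets_gen_by_times
  by (induction A rule: sigma_sets.induct) (use assms(2,3) eq in auto)

lemma aug_F_minus_local:
  assumes A: "A \<in> sets (aug_F_minus t)" and w: "w \<in> space aug_F" "w' \<in> space aug_F" "fst w = fst w'"
    and eq: "\<And>s. 0 \<le> s \<Longrightarrow> ennreal s < t \<Longrightarrow> snd w s = snd w' s"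
  shows "w \<in> A \<longleftrightarrow> w' \<in> A"
  using A unfolding aug_F_minus_def sets_pair_measure
proof (induction A rule: sigma_sets.induct)
  case (Basic a)
  then obtain B C where a: "a = B \<times> C" "C \<in> sets (path_F_minus t)" by auto
  have "snd w \<in> C \<longleftrightarrow> snd w' \<in> C"
    by (rule gen_by_times_local[of _ "{s. 0 \<le> s \<and> ennreal s < t}"])
       (use a w eq in \<open>auto simp: path_F_minus_def space_aug_F\<close>)
  then show ?case using a w(3) by (simp add: mem_Times_iff)
next
  case (Compl a)
  then show ?case using w by (auto simp: space_aug_F)
qed auto

text \<open>The set where \<open>T\<close> is at most \<open>T w\<close> contains \<open>w\<close>,
  hence also \<open>w'\<close>, so \<open>T w' \<le> T w\<close>. Therefore the level
  \<open>T w'\<close> is admissible too, and the same test there gives the reverse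
  inequality.\<close>

lemma stopping_time_local:
  assumes T: "stopping_time G T" and W: "\<And>t. space (G t) = W" "w \<in> W" "w' \<in> W"
    and loc: "\<And>A t. A \<in> sets (G t) \<Longrightarrow> t \<le> T w \<Longrightarrow> w \<in> A \<longleftrightarrow> w' \<in> A"
  shows "T w' = T w"
proof -
  have *: "T w \<le> t \<longleftrightarrow> T w' \<le> t" if "t \<le> T w" for t
    using loc[of "{v \<in> space (G t). T v \<le> t}" t] stopping_timeD[OF T, of t] that W
    by (auto simp: Measurable.pred_def)
  have "T w' \<le> T w" using *[of "T w"] by simp
  with *[of "T w'"] show ?thesis by simp
qed

lemma restrict_0_extensional: "w \<in> cadlag \<Longrightarrow> (\<lambda>t\<in>{0..}. w t) = w"
  by (rule extensional_restrict[OF cadlag_extensional])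

section \<open>Pasted and controlled paths\<close>

lemma pieces_time_0 [simp]: "pieces_time \<tau> 0 e = 0"
  by (simp add: pieces_time_def)

lemma pieces_time_Suc: "pieces_time \<tau> (Suc k) e = \<tau> (Suc k) (pasted \<tau> e k)"
  by (simp add: pieces_time_def)

lemma fst_pasted [simp]: "fst (pasted \<tau> e k) = fst e"
  by (cases k) (simp_all add: Let_def)

lemma snd_pasted_Suc:
  "snd (pasted \<tau> e (Suc k)) = (\<lambda>t\<in>{0..}. if ennreal t < pieces_time \<tau> (Suc k) e
     then snd (pasted \<tau> e k) t else snd e (Suc k) (t - enn2real (pieces_time \<tau> (Suc k) e)))"
  unfolding pieces_time_Suc by (simp add: Let_def)

lemma pasted_in_space: "e \<in> space pieces_G \<Longrightarrow> pasted \<tau> e k \<in> space aug_F"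
proof (induction k)
  case 0
  then show ?case by (auto simp: space_pieces_G space_aug_F)
next
  case (Suc k)
  then have "snd (pasted \<tau> e (Suc k)) \<in> cadlag"
    unfolding snd_pasted_Suc by (intro cadlag_paste) (auto simp: space_pieces_G space_aug_F)
  then show ?case by (simp add: space_aug_F mem_Times_iff del: pasted.simps)
qed

lemma measurable_pieces_fst [measurable]: "fst \<in> borel_measurable pieces_G"
  by (simp add: pieces_G_def)

lemma measurable_pieces_component [measurable]: "(\<lambda>e. snd e k) \<in> pieces_G \<rightarrow>\<^sub>M path_F"
  unfolding pieces_G_def by (rule measurable_compose[OF measurable_snd measurable_component_singleton]) simp

lemma measurable_aug_fst [measurable]: "fst \<in> borel_measurable aug_F"
  by (simp add: aug_F_def)

lemma measurable_aug_snd [measurable]: "snd \<in> aug_F \<rightarrow>\<^sub>M path_F"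
  by (simp add: aug_F_def)

lemma measurable_aug_FI:
  "(\<lambda>x. fst (f x)) \<in> borel_measurable N \<Longrightarrow> (\<lambda>x. snd (f x)) \<in> N \<rightarrow>\<^sub>M path_F \<Longrightarrow> f \<in> N \<rightarrow>\<^sub>M aug_F"
  unfolding aug_F_def by (rule measurable_pair) (simp_all add: comp_def)

lemma measurable_pasted:
  assumes "\<And>k. \<tau> k \<in> borel_measurable aug_F"
  shows "(\<lambda>e. pasted \<tau> e k) \<in> pieces_G \<rightarrow>\<^sub>M aug_F"
proof (induction k)
  case 0
  show ?case by (rule measurable_aug_FI) simp_all
next
  case (Suc k)
  have T [measurable]: "pieces_time \<tau> (Suc k) \<in> borel_measurable pieces_G"
    using measurable_compose[OF Suc assms] by (simp add: pieces_time_Suc[abs_def])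
  show ?case
  proof (rule measurable_aug_FI)
    show "(\<lambda>e. snd (pasted \<tau> e (Suc k))) \<in> pieces_G \<rightarrow>\<^sub>M path_F"
    proof (rule measurable_path_FI)
      fix s :: real assume s: "0 \<le> s"
      have [measurable]: "(\<lambda>e. snd (pasted \<tau> e k) s) \<in> borel_measurable pieces_G"
        using measurable_compose[OF Suc measurable_compose[OF measurable_aug_snd measurable_path_value[OF s]]] .
      \<comment> \<open>The time is negative if \<open>s\<close> precedes a finite junction; that
        value is discarded, but it must still be measurable.\<close>
      have [measurable]: "(\<lambda>e. snd e (Suc k) (s - enn2real (pieces_time \<tau> (Suc k) e))) \<in> borel_measurable pieces_G"
        by (rule measurable_path_eval) measurable
      show "(\<lambda>e. snd (pasted \<tau> e (Suc k)) s) \<in> borel_measurable pieces_G"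
        unfolding snd_pasted_Suc using s by simp
    qed (use pasted_in_space[of _ \<tau> "Suc k"] in \<open>auto simp: space_aug_F mem_Times_iff simp del: pasted.simps\<close>)
  qed (simp del: pasted.simps)
qed

lemma measurable_pieces_time:
  assumes "\<And>k. \<tau> k \<in> borel_measurable aug_F"
  shows "pieces_time \<tau> k \<in> borel_measurable pieces_G"
  using measurable_compose[OF measurable_pasted[OF assms] assms]
  by (cases k) (simp_all add: pieces_time_Suc[abs_def] pieces_time_0[abs_def])

section \<open>Measurability of cycles with a random lifetime\<close>

lemma space_option_borel [simp]: "space option_borel = UNIV"
  by (simp add: option_borel_def space_measure_of_conv)

lemma measurable_Some: "Some \<in> borel \<rightarrow>\<^sub>M option_borel"
  unfolding option_borel_def by (rule measurable_measure_of) (auto simp: inj_vimage_image_eq)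

lemma measurable_option_If:
  assumes "Measurable.pred N p" "f \<in> borel_measurable N"
  shows "(\<lambda>x. if p x then Some (f x) else None) \<in> N \<rightarrow>\<^sub>M option_borel"
  using assms measurable_compose[OF assms(2) measurable_Some] by (intro measurable_If) (auto simp: pred_def)

text \<open>The shape of a cycle in its own clock: it needs a length and a path, but not the
  absolute time at which the cycle begins.\<close>

definition killed :: "ennreal \<Rightarrow> 'e path \<Rightarrow> real \<Rightarrow> 'e option" where
  "killed L w = (\<lambda>s\<in>{0..}. if ennreal s < L then Some (w s) else None)"

lemma measurable_killed [measurable (raw)]:
  assumes [measurable]: "L \<in> borel_measurable N" and f: "f \<in> N \<rightarrow>\<^sub>M path_F"
  shows "(\<lambda>x. killed (L x) (f x)) \<in> N \<rightarrow>\<^sub>M cycle_space"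
  unfolding killed_def cycle_space_def
proof (rule measurable_restrict, rule measurable_option_If)
  show "(\<lambda>x. f x s) \<in> borel_measurable N" if "s \<in> {0..}" for s
    using that by (intro measurable_compose[OF f measurable_path_value]) auto
qed measurable

lemma measurable_cycle_process:
  assumes [measurable]: "\<And>k. \<tau> k \<in> borel_measurable aug_F"
  shows "cycle_process \<tau> k \<in> aug_F \<rightarrow>\<^sub>M cycle_space"
  unfolding cycle_process_def[abs_def] cycle_space_def
proof (rule measurable_restrict, rule measurable_option_If)
  show "(\<lambda>w. snd w (enn2real (\<tau> k w) + s)) \<in> borel_measurable aug_F" for s
    by (rule measurable_path_eval) measurable
qed measurable

lemma nat_0_1_ge2 [case_names 0 1 ge2]:
  "(k = 0 \<Longrightarrow> R) \<Longrightarrow> (k = 1 \<Longrightarrow> R) \<Longrightarrow> (2 \<le> k \<Longrightarrow> R) \<Longrightarrow> R" for k :: nat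
  by linarith

lemma ennreal_enn2real_add: "T < \<infinity> \<Longrightarrow> 0 \<le> s \<Longrightarrow> ennreal (enn2real T + s) = T + ennreal s"
  by (simp add: ennreal_plus less_top)

text \<open>Countably many thresholds suffice, which makes the event of nonaccumulation visibly
  measurable.\<close>

lemma tendsto_infinity_iff_nat:
  "(f \<longlongrightarrow> (\<infinity>::ennreal)) F \<longleftrightarrow> (\<forall>n::nat. \<forall>\<^sub>F x in F. of_nat n < f x)"
proof
  assume *: "\<forall>n::nat. \<forall>\<^sub>F x in F. of_nat n < f x"
  show "(f \<longlongrightarrow> \<infinity>) F" unfolding infinity_ennreal_def tendsto_top_iff_ennreal
  proof (intro allI impI)
    fix l :: real
    obtain n :: nat where "l \<le> real n" using real_arch_simple by blast
    then have le: "ennreal l \<le> of_nat n" by (simp add: ennreal_leI flip: ennreal_of_nat_eq_real_of_nat)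
    moreover have "\<forall>\<^sub>F x in F. of_nat n < f x" using * by blast
    ultimately show "\<forall>\<^sub>F x in F. ennreal l < f x" by (auto elim!: eventually_mono intro: le_less_trans[OF le])
  qed
qed (simp add: order_tendstoD(1) of_nat_less_top)

lemma fst_controlled [simp]: "fst (controlled ebar \<tau> e) = fst e"
  by (simp add: controlled_def)

lemma pieces_time_exceeds:
  assumes "(\<lambda>k. pieces_time \<tau> k e) \<longlonglongrightarrow> \<infinity>"
  shows "\<forall>\<^sub>F k in sequentially. ennreal t < pieces_time \<tau> (Suc k) e"
proof -
  have "\<forall>\<^sub>F k in sequentially. ennreal t < pieces_time \<tau> k e"
    using order_tendstoD(1)[OF assms, of "ennreal t"] by simp
  then show ?thesis by (rule eventually_compose_filterlim[OF _ filterlim_Suc])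
qed

lemma controlled_dummy:
  "\<not> (\<lambda>k. pieces_time \<tau> k e) \<longlonglongrightarrow> \<infinity> \<Longrightarrow> snd (controlled ebar \<tau> e) = (\<lambda>t\<in>{0..}. ebar)"
  by (simp add: controlled_def)

text \<open>At an infinite intervention time the pasting step keeps the old path and never looks at
  the new component. This is what later permits exchanging unreached pieces for dummies.\<close>

lemma pasted_cong_reached:
  assumes "fst e = fst e'" "snd e 0 = snd e' 0"
    and "\<And>k. pieces_time \<tau> (Suc k) e < \<infinity> \<Longrightarrow> snd e (Suc k) = snd e' (Suc k)"
  shows "pasted \<tau> e' k = pasted \<tau> e k"
proof (induction k)
  case 0
  then show ?case using assms by simp
next
  case (Suc k)
  have "snd (pasted \<tau> e' (Suc k)) = snd (pasted \<tau> e (Suc k))"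
    using assms(3)[of k]
    by (cases "pieces_time \<tau> (Suc k) e") (auto simp: snd_pasted_Suc pieces_time_Suc Suc simp del: pasted.simps)
  then show ?case using assms(1) by (intro prod_eqI) (simp_all del: pasted.simps)
qed

lemma pasted_cong_upto:
  assumes "fst e = fst e'" "\<And>i. i \<le> k \<Longrightarrow> snd e i = snd e' i"
  shows "pasted \<tau> e k = pasted \<tau> e' k"
  using assms by (induction k) (simp_all add: Let_def cong: if_cong)

lemma measurable_pieces_GI:
  assumes "(\<lambda>x. fst (f x)) \<in> borel_measurable N" "\<And>k. (\<lambda>x. snd (f x) k) \<in> N \<rightarrow>\<^sub>M path_F"
  shows "f \<in> N \<rightarrow>\<^sub>M pieces_G"
  unfolding pieces_G_def
proof (rule measurable_pair)
  have "(\<lambda>x k. snd (f x) k) \<in> N \<rightarrow>\<^sub>M PiM UNIV (\<lambda>_. path_F)"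
    by (rule measurable_PiM_single') (use measurable_space[OF assms(2)] assms(2) in auto)
  then show "snd \<circ> f \<in> N \<rightarrow>\<^sub>M PiM UNIV (\<lambda>_. path_F)" by (simp add: comp_def)
qed (use assms in \<open>simp add: comp_def\<close>)

section \<open>Intervention times along pasted and controlled paths\<close>

locale nominal_policy =
  fixes MZ :: "'z measure" and \<tau> :: "nat \<Rightarrow> 'e::polish_space aug \<Rightarrow> ennreal" and Z :: "nat \<Rightarrow> 'e aug \<Rightarrow> 'z"
  assumes nominal: "nominal_impulse_policy MZ \<tau> Z"
begin

lemma tau_0: "w \<in> space aug_F \<Longrightarrow> \<tau> 0 w = 0"
  using nominal by (simp add: nominal_impulse_policy_def)

lemma stopping_time_tau_1: "stopping_time aug_F_minus (\<tau> 1)"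
  using nominal by (simp add: nominal_impulse_policy_def)

lemma tau_path:
  assumes "2 \<le> k"
  obtains T \<zeta> where "stopping_time path_F_minus T" "\<zeta> \<in> past_before path_F_minus T \<rightarrow>\<^sub>M MZ"
    "\<And>w. w \<in> space aug_F \<Longrightarrow> \<tau> k w = T (snd w)" "\<And>w. w \<in> space aug_F \<Longrightarrow> Z k w = \<zeta> (snd w)"
  using nominal assms unfolding nominal_impulse_policy_def by metis

lemma measurable_tau [measurable]: "\<tau> k \<in> borel_measurable aug_F"
proof (cases k rule: nat_0_1_ge2)
  case 0
  then show ?thesis by (subst measurable_cong[where g="\<lambda>_. 0"]) (auto simp: tau_0)
next
  case 1
  show ?thesis unfolding 1
    by (rule measurable_stopping_time[OF stopping_time_tau_1 sets_aug_F_minus_subset])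
       (simp add: space_aug_F space_aug_F_minus)
next
  case ge2
  obtain T where T: "stopping_time path_F_minus T"
    "\<And>w. w \<in> space aug_F \<Longrightarrow> \<tau> k w = T (snd w)" using tau_path[OF ge2] by metis
  have "T \<in> borel_measurable path_F"
    by (rule measurable_stopping_time[OF T(1) sets_path_F_minus_subset]) simp
  then show ?thesis
    using measurable_compose[OF measurable_aug_snd] by (subst measurable_cong[OF T(2)]) auto
qed

text \<open>The kernel \<open>Q\<close> yields probability measures only for impulses in the space
  of \<open>MZ\<close>.\<close>

lemma Z_in_space:
  assumes "1 \<le> k" "w \<in> space aug_F"
  shows "Z k w \<in> space MZ"
proof (cases k rule: nat_0_1_ge2)
  case 1
  have "Z 1 \<in> aug_past_before (\<tau> 1) \<rightarrow>\<^sub>M MZ"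
    using nominal by (simp add: nominal_impulse_policy_def)
  from measurable_space[OF this, of w] show ?thesis
    using assms 1 by (simp add: aug_past_before_def space_measure_of_conv space_aug_F)
next
  case ge2
  obtain T \<zeta> where \<zeta>: "\<zeta> \<in> past_before path_F_minus T \<rightarrow>\<^sub>M MZ"
    "\<And>w. w \<in> space aug_F \<Longrightarrow> Z k w = \<zeta> (snd w)" using tau_path[OF ge2] by metis
  from measurable_space[OF \<zeta>(1), of "snd w"] show ?thesis
    using assms \<zeta>(2) by (auto simp: past_before_def space_measure_of_conv space_aug_F)
qed (use assms in simp)

lemma tau_mono: "w \<in> space aug_F \<Longrightarrow> \<tau> k w \<le> \<tau> (Suc k) w"
  using nominal tau_0[of w]
  by (cases "k = 0"; cases "\<tau> k w < \<infinity>") (auto simp: nominal_impulse_policy_def less_top[symmetric] intro: less_imp_le)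

text \<open>Galmarini's test.\<close>

lemma tau_local:
  assumes w: "w \<in> space aug_F" "w' \<in> space aug_F" "fst w = fst w'"
    and eq: "\<And>s. 0 \<le> s \<Longrightarrow> ennreal s < \<tau> k w \<Longrightarrow> snd w s = snd w' s"
  shows "\<tau> k w' = \<tau> k w"
proof (cases k rule: nat_0_1_ge2)
  case 0
  then show ?thesis using w by (simp add: tau_0)
next
  case 1
  show ?thesis unfolding 1
  proof (rule stopping_time_local[OF stopping_time_tau_1])
    fix A :: "'e aug set" and t assume "A \<in> sets (aug_F_minus t)" "t \<le> \<tau> 1 w"
    then show "w \<in> A \<longleftrightarrow> w' \<in> A"
      using w eq 1 by (intro aug_F_minus_local) (auto intro: less_le_trans)
  qed (use w in \<open>auto simp: space_aug_F space_aug_F_minus\<close>)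
next
  case ge2
  obtain T where T: "stopping_time path_F_minus T"
    "\<And>w. w \<in> space aug_F \<Longrightarrow> \<tau> k w = T (snd w)" using tau_path[OF ge2] by metis
  have "T (snd w') = T (snd w)"
  proof (rule stopping_time_local[OF T(1)])
    fix A :: "'e path set" and t assume A: "A \<in> sets (path_F_minus t)" "t \<le> T (snd w)"
    show "snd w \<in> A \<longleftrightarrow> snd w' \<in> A"
      by (rule gen_by_times_local[OF A(1)[unfolded path_F_minus_def]])
         (use A w eq in \<open>auto simp: T(2) space_aug_F intro: less_le_trans\<close>)
  qed (use w in \<open>auto simp: space_aug_F\<close>)
  then show ?thesis using w by (simp add: T(2))
qed

text \<open>The new piece is attached from the intervention time on, and the strict past before that
  time does not see it; so the replacement cannot move the intervention.\<close>

lemma tau_pasted: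
  assumes e: "e \<in> space pieces_G"
  shows "\<tau> k (pasted \<tau> e k) = pieces_time \<tau> k e"
proof (cases k)
  case 0
  then show ?thesis using pasted_in_space[OF e, of \<tau> 0] by (simp add: tau_0)
next
  case (Suc j)
  show ?thesis unfolding Suc pieces_time_Suc
    by (rule tau_local)
       (use pasted_in_space[OF e] in \<open>simp_all add: snd_pasted_Suc pieces_time_Suc del: pasted.simps\<close>)
qed

text \<open>The two times are defined on different paths. By \<open>tau_pasted\<close> both can be
  read from \<open>pasted \<tau> e k\<close>, where \<open>tau_mono\<close> compares them.\<close>

lemma pieces_time_mono: "e \<in> space pieces_G \<Longrightarrow> pieces_time \<tau> k e \<le> pieces_time \<tau> (Suc k) e"
  using tau_mono[OF pasted_in_space, of e k \<tau> k] by (simp add: tau_pasted pieces_time_Suc)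

lemma pieces_time_mono_le:
  "e \<in> space pieces_G \<Longrightarrow> i \<le> j \<Longrightarrow> pieces_time \<tau> i e \<le> pieces_time \<tau> j e"
  by (rule lift_Suc_mono_le[of "\<lambda>k. pieces_time \<tau> k e"]) (rule pieces_time_mono)

lemma controlled_eq_pasted:
  assumes e: "e \<in> space pieces_G" and lim: "(\<lambda>k. pieces_time \<tau> k e) \<longlonglongrightarrow> \<infinity>"
    and t: "0 \<le> t" "ennreal t < pieces_time \<tau> (Suc n) e"
  shows "snd (controlled ebar \<tau> e) t = snd (pasted \<tau> e n) t"
proof -
  \<comment> \<open>The index of the cycle containing \<open>t\<close>. By monotonicity of the times
    it is also the one that the \<open>THE\<close> in \<open>controlled\<close> selects.\<close>
  define k where "k = (LEAST k. ennreal t < pieces_time \<tau> (Suc k) e)"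
  have k2: "ennreal t < pieces_time \<tau> (Suc k) e" unfolding k_def by (rule LeastI[of _ n]) (rule t)
  have kn: "k \<le> n" unfolding k_def by (rule Least_le) (rule t)
  have k1: "pieces_time \<tau> k e \<le> ennreal t"
  proof (cases k)
    case (Suc j)
    then have "\<not> ennreal t < pieces_time \<tau> (Suc j) e"
      unfolding k_def using not_less_Least by (metis lessI)
    then show ?thesis using Suc by simp
  qed simp
  have "(THE k. pieces_time \<tau> k e \<le> ennreal t \<and> ennreal t < pieces_time \<tau> (Suc k) e) = k"
  proof (rule the_equality)
    fix i assume i: "pieces_time \<tau> i e \<le> ennreal t \<and> ennreal t < pieces_time \<tau> (Suc i) e"
    then have "\<not> i < k" unfolding k_def using not_less_Least by blast
    moreover have "\<not> Suc k \<le> i" using pieces_time_mono_le[OF e, of "Suc k" i] i k2 by auto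
    ultimately show "i = k" by simp
  qed (use k1 k2 in simp)
  then have "snd (controlled ebar \<tau> e) t = snd e k (t - enn2real (pieces_time \<tau> k e))"
    using lim t by (simp add: controlled_def)
  also have "\<dots> = snd (pasted \<tau> e n) t"
    by (rule pasted_segment[symmetric]) (use pieces_time_mono[OF e] kn t k1 k2 in auto)
  finally show ?thesis .
qed

lemma controlled_in_space:
  assumes e: "e \<in> space pieces_G"
  shows "controlled ebar \<tau> e \<in> space aug_F"
proof (cases "(\<lambda>k. pieces_time \<tau> k e) \<longlonglongrightarrow> \<infinity>")
  case True
  have "snd (controlled ebar \<tau> e) \<in> cadlag"
  proof (rule cadlag_local)
    fix t :: real assume t: "0 \<le> t"
    \<comment> \<open>The margin up to \<open>t + 1\<close> provides agreement strictly beyond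
      \<open>t\<close>.\<close>
    obtain n where n: "ennreal (t + 1) < pieces_time \<tau> (Suc n) e"
      using eventually_happens[OF pieces_time_exceeds[OF True]] by auto
    have "ennreal s < pieces_time \<tau> (Suc n) e" if "0 \<le> s" "s < t + 1" for s
      by (rule le_less_trans[OF _ n]) (use that in \<open>simp add: ennreal_leI\<close>)
    then show "\<exists>v\<in>cadlag. \<exists>r>t. \<forall>s. 0 \<le> s \<longrightarrow> s < r \<longrightarrow> snd (controlled ebar \<tau> e) s = v s"
      using pasted_in_space[OF e, of \<tau> n] controlled_eq_pasted[OF e True]
      by (intro bexI[of _ "snd (pasted \<tau> e n)"] exI[of _ "t + 1"]) (auto simp: space_aug_F mem_Times_iff)
  qed (simp add: controlled_def)
  then show ?thesis by (simp add: space_aug_F mem_Times_iff)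
qed (simp add: space_aug_F mem_Times_iff controlled_dummy cadlag_const)

lemma measurable_nonaccumulating [measurable]:
  "Measurable.pred pieces_G (\<lambda>e. (\<lambda>k. pieces_time \<tau> k e) \<longlonglongrightarrow> \<infinity>)"
proof -
  note measurable_pieces_time[OF measurable_tau, measurable]
  show ?thesis unfolding tendsto_infinity_iff_nat eventually_sequentially by measurable
qed

text \<open>At a fixed time the controlled path is the limit of the pasted paths, eventually
  constant in \<open>n\<close>. This bypasses the random cycle index hidden in the
  \<open>THE\<close> of the definition.\<close>

lemma measurable_controlled [measurable]: "controlled ebar \<tau> \<in> pieces_G \<rightarrow>\<^sub>M aug_F"
proof (rule measurable_aug_FI)
  show "(\<lambda>e. snd (controlled ebar \<tau> e)) \<in> pieces_G \<rightarrow>\<^sub>M path_F"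
  proof (rule measurable_path_FI)
    fix s :: real assume s: "0 \<le> s"
    let ?good = "\<lambda>e. (\<lambda>k. pieces_time \<tau> k e) \<longlonglongrightarrow> \<infinity>"
    show "(\<lambda>e. snd (controlled ebar \<tau> e) s) \<in> borel_measurable pieces_G"
    proof (rule borel_measurable_LIMSEQ_metric)
      fix n
      have [measurable]: "(\<lambda>e. snd (pasted \<tau> e n) s) \<in> borel_measurable pieces_G"
        using measurable_compose[OF measurable_pasted[OF measurable_tau]
            measurable_compose[OF measurable_aug_snd measurable_path_value[OF s]]] .
      show "(\<lambda>e. if ?good e then snd (pasted \<tau> e n) s else ebar) \<in> borel_measurable pieces_G"
        by measurable
    next
      fix e :: "'e pieces" assume e: "e \<in> space pieces_G"
      show "(\<lambda>n. if ?good e then snd (pasted \<tau> e n) s else ebar) \<longlonglongrightarrow> snd (controlled ebar \<tau> e) s"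
      proof (cases "?good e")
        case True
        have "\<forall>\<^sub>F n in sequentially. snd (pasted \<tau> e n) s = snd (controlled ebar \<tau> e) s"
          using pieces_time_exceeds[OF True, of s]
          by (rule eventually_mono) (simp add: controlled_eq_pasted[OF e True s])
        then show ?thesis using True by (auto intro: tendsto_eventually)
      qed (use s in \<open>simp add: controlled_dummy\<close>)
    qed
  qed (use controlled_in_space in \<open>simp add: space_aug_F mem_Times_iff\<close>)
qed simp

lemma tau_controlled:
  assumes e: "e \<in> space pieces_G" and lim: "(\<lambda>k. pieces_time \<tau> k e) \<longlonglongrightarrow> \<infinity>"
  shows "\<tau> k (controlled ebar \<tau> e) = pieces_time \<tau> k e"
proof (cases k)
  case 0
  then show ?thesis using controlled_in_space[OF e] by (simp add: tau_0)
next
  case (Suc j)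
  show ?thesis unfolding Suc pieces_time_Suc
    by (rule tau_local)
       (use pasted_in_space[OF e] controlled_in_space[OF e] controlled_eq_pasted[OF e lim] in
         \<open>simp_all add: pieces_time_Suc\<close>)
qed

end

section \<open>Lengths and restart laws determined cycle by cycle\<close>

locale independent_cycles =
  fixes MZ :: "'z measure" and Q :: "'e::polish_space \<times> 'z \<Rightarrow> 'e measure"
    and \<tau> :: "nat \<Rightarrow> 'e aug \<Rightarrow> ennreal" and Z :: "nat \<Rightarrow> 'e aug \<Rightarrow> 'z"
  assumes independent_cycles: "independent_cycles_policy MZ Q \<tau> Z"
begin

sublocale nominal_policy MZ \<tau> Z
  by standard (use independent_cycles in \<open>simp add: independent_cycles_policy_def\<close>)

text \<open>A choice of the random time of condition (a) for intervention \<open>k + 1\<close>,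
  indexed by the cycle whose length it gives. It serves \<open>k \<ge> 1\<close> only, since the
  length of cycle 0 also depends on the value at \<open>0-\<close>.\<close>

definition len :: "nat \<Rightarrow> 'e path \<Rightarrow> ennreal" where
  "len k = (SOME \<sigma>. \<sigma> \<in> borel_measurable path_F \<and> (\<forall>w\<in>space aug_F. \<tau> k w < \<infinity> \<longrightarrow>
     \<tau> (Suc k) w = \<tau> k w + \<sigma> (path_shift (enn2real (\<tau> k w)) (snd w))))"

lemma
  assumes "1 \<le> k"
  shows measurable_len: "len k \<in> borel_measurable path_F"
    and tau_Suc: "\<And>w. w \<in> space aug_F \<Longrightarrow> \<tau> k w < \<infinity> \<Longrightarrow>
      \<tau> (Suc k) w = \<tau> k w + len k (path_shift (enn2real (\<tau> k w)) (snd w))"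
proof -
  have "\<exists>\<sigma>\<in>borel_measurable path_F. \<forall>w\<in>space aug_F. \<tau> (Suc k - 1) w < \<infinity> \<longrightarrow>
      \<tau> (Suc k) w = \<tau> (Suc k - 1) w + \<sigma> (path_shift (enn2real (\<tau> (Suc k - 1) w)) (snd w))"
    using independent_cycles assms unfolding independent_cycles_policy_def by (metis Suc_1 Suc_le_mono One_nat_def)
  then have "\<exists>\<sigma>. \<sigma> \<in> borel_measurable path_F \<and> (\<forall>w\<in>space aug_F. \<tau> k w < \<infinity> \<longrightarrow>
      \<tau> (Suc k) w = \<tau> k w + \<sigma> (path_shift (enn2real (\<tau> k w)) (snd w)))" by auto
  from someI_ex[OF this, folded len_def]
  show "len k \<in> borel_measurable path_F"
    "\<And>w. w \<in> space aug_F \<Longrightarrow> \<tau> k w < \<infinity> \<Longrightarrow>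
      \<tau> (Suc k) w = \<tau> k w + len k (path_shift (enn2real (\<tau> k w)) (snd w))" by blast+
qed

text \<open>A function of component \<open>k\<close> alone, together with the value at
  \<open>0-\<close> if \<open>k = 0\<close>. It is the length of cycle \<open>k\<close> only when
  that cycle begins, but it is defined in any case, which is what makes product events
  possible.\<close>

definition lifetime :: "nat \<Rightarrow> 'e pieces \<Rightarrow> ennreal" where
  "lifetime k e = (case k of 0 \<Rightarrow> \<tau> 1 (fst e, snd e 0) | Suc _ \<Rightarrow> len k (snd e k))"

lemma lifetime_0: "lifetime 0 e = \<tau> 1 (fst e, snd e 0)"
  and lifetime_Suc: "lifetime (Suc k) e = len (Suc k) (snd e (Suc k))"
  by (simp_all add: lifetime_def)

text \<open>Piece \<open>k\<close> is the last one in \<open>pasted \<tau> e k\<close> and is not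
  yet cut off, so the shift recovers all of it.\<close>

lemma path_shift_pasted:
  assumes e: "e \<in> space pieces_G" and T: "pieces_time \<tau> k e < \<infinity>"
  shows "path_shift (enn2real (pieces_time \<tau> k e)) (snd (pasted \<tau> e k)) = snd e k"
proof -
  have *: "snd e k \<in> cadlag" using e by (auto simp: space_pieces_G)
  have "path_shift (enn2real (pieces_time \<tau> k e)) (snd (pasted \<tau> e k)) = (\<lambda>s\<in>{0..}. snd e k s)"
    unfolding path_shift_def
  proof (rule restrict_ext)
    fix s :: real assume "s \<in> {0..}"
    then show "snd (pasted \<tau> e k) (enn2real (pieces_time \<tau> k e) + s) = snd e k s"
      by (subst pasted_segment[where i=k])
         (use T pieces_time_mono[OF e] in \<open>simp_all add: ennreal_enn2real_add[unfolded infinity_ennreal_def]\<close>)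
  qed
  then show ?thesis by (simp add: restrict_0_extensional[OF *])
qed

text \<open>Condition (a) applied to \<open>pasted \<tau> e k\<close>, whose shift at the
  \<open>k\<close>-th time is exactly piece \<open>k\<close>. Thus the times become partial sums of
  lengths of separate pieces.\<close>

lemma pieces_time_Suc_add:
  assumes e: "e \<in> space pieces_G" and T: "pieces_time \<tau> k e < \<infinity>"
  shows "pieces_time \<tau> (Suc k) e = pieces_time \<tau> k e + lifetime k e"
proof (cases k)
  case (Suc j)
  have "pieces_time \<tau> (Suc k) e = \<tau> k (pasted \<tau> e k) +
      len k (path_shift (enn2real (\<tau> k (pasted \<tau> e k))) (snd (pasted \<tau> e k)))"
    unfolding pieces_time_Suc[of \<tau> k]
    by (rule tau_Suc) (use Suc T in \<open>simp_all add: pasted_in_space[OF e] tau_pasted[OF e] del: pasted.simps\<close>)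
  then show ?thesis
    unfolding tau_pasted[OF e] path_shift_pasted[OF e T] by (simp add: Suc lifetime_Suc)
qed (simp add: lifetime_0 pieces_time_Suc)

text \<open>Splits the occurrence of intervention \<open>n\<close> into one condition on each
  earlier piece; nothing is asked of the length of cycle \<open>n\<close>.\<close>

lemma pieces_time_finite_iff:
  assumes e: "e \<in> space pieces_G"
  shows "pieces_time \<tau> n e < \<infinity> \<longleftrightarrow> (\<forall>j<n. lifetime j e < \<infinity>)"
proof (induction n)
  case (Suc n)
  have "pieces_time \<tau> (Suc n) e < \<infinity> \<longleftrightarrow> pieces_time \<tau> n e < \<infinity> \<and> lifetime n e < \<infinity>"
    using pieces_time_Suc_add[OF e, of n] pieces_time_mono[OF e, of n]
    by (cases "pieces_time \<tau> n e < \<infinity>") (auto simp: less_top[symmetric] top_unique)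
  then show ?case using Suc less_Suc_eq by auto
qed simp

text \<open>Finiteness of the \<open>k\<close>-th time is essential: otherwise the left side is
  \<open>None\<close> throughout, while piece \<open>k\<close> still exists and may have a positive
  lifetime.\<close>

lemma cycle_process_controlled:
  assumes e: "e \<in> space pieces_G" and lim: "(\<lambda>k. pieces_time \<tau> k e) \<longlonglongrightarrow> \<infinity>"
    and T: "pieces_time \<tau> k e < \<infinity>"
  shows "cycle_process \<tau> k (controlled ebar \<tau> e) = killed (lifetime k e) (snd e k)"
  unfolding cycle_process_def killed_def tau_controlled[OF e lim]
proof (rule restrict_ext)
  fix s :: real assume "s \<in> {0..}"
  then have s: "0 \<le> s" by simp
  have iff: "pieces_time \<tau> k e + ennreal s < pieces_time \<tau> (Suc k) e \<longleftrightarrow> ennreal s < lifetime k e"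
    unfolding pieces_time_Suc_add[OF e T] using T by (simp add: ennreal_add_left_cancel_less less_top)
  have "snd (controlled ebar \<tau> e) (enn2real (pieces_time \<tau> k e) + s) = snd e k s"
    if "ennreal s < lifetime k e"
  proof -
    have "snd (controlled ebar \<tau> e) (enn2real (pieces_time \<tau> k e) + s) =
        snd (pasted \<tau> e k) (enn2real (pieces_time \<tau> k e) + s)"
    proof (rule controlled_eq_pasted[OF e lim])
      show "ennreal (enn2real (pieces_time \<tau> k e) + s) < pieces_time \<tau> (Suc k) e"
        unfolding ennreal_enn2real_add[OF T s] iff by (rule that)
    qed (simp add: s)
    also have "\<dots> = path_shift (enn2real (pieces_time \<tau> k e)) (snd (pasted \<tau> e k)) s"
      using s by (simp add: path_shift_def)
    finally show ?thesis unfolding path_shift_pasted[OF e T] .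
  qed
  with iff show "(if pieces_time \<tau> k e + ennreal s < pieces_time \<tau> (Suc k) e
      then Some (snd (controlled ebar \<tau> e) (enn2real (pieces_time \<tau> k e) + s)) else None) =
    (if ennreal s < lifetime k e then Some (snd e k s) else None)" by simp
qed

definition intervention :: "nat \<Rightarrow> 'e aug \<Rightarrow> 'e measure" where
  "intervention k w = Q (aug_left w (enn2real (\<tau> k w)), Z k w)"

lemma intervention_const:
  "1 \<le> k \<Longrightarrow> w \<in> space aug_F \<Longrightarrow> w' \<in> space aug_F \<Longrightarrow> \<tau> k w < \<infinity> \<Longrightarrow> \<tau> k w' < \<infinity> \<Longrightarrow>
    intervention k w = intervention k w'"
  using independent_cycles unfolding independent_cycles_policy_def intervention_def by blast

text \<open>If the \<open>k\<close>-th intervention never happens, the value of \<open>restart k\<close> is irrelevant.\<close>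

definition restart :: "nat \<Rightarrow> 'e measure" where
  "restart k = (if \<exists>w\<in>space aug_F. \<tau> k w < \<infinity>
     then intervention k (SOME w. w \<in> space aug_F \<and> \<tau> k w < \<infinity>) else return borel undefined)"

lemma restart_eq:
  assumes "1 \<le> k" "w \<in> space aug_F" "\<tau> k w < \<infinity>"
  shows "restart k = intervention k w"
proof -
  have "\<exists>w. w \<in> space aug_F \<and> \<tau> k w < \<infinity>" using assms by blast
  note w' = someI_ex[OF this]
  have "restart k = intervention k (SOME w. w \<in> space aug_F \<and> \<tau> k w < \<infinity>)"
    unfolding restart_def using assms by (intro if_P) blast
  also have "\<dots> = intervention k w"
    by (rule intervention_const) (use w' assms in blast)+
  finally show ?thesis .
qed

lemma restart_law_eq:
  assumes e: "e \<in> space pieces_G"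
  shows "restart_law Q ebar zbar \<tau> Z k e =
    (if pieces_time \<tau> (Suc k) e < \<infinity> then restart (Suc k) else return borel ebar)"
proof (cases "pieces_time \<tau> (Suc k) e < \<infinity>")
  case True
  then have "restart (Suc k) = intervention (Suc k) (pasted \<tau> e k)"
    by (intro restart_eq pasted_in_space[OF e]) (simp_all add: pieces_time_Suc)
  then show ?thesis using True
    by (simp add: restart_law_def pieces_state_def pieces_impulse_def intervention_def pieces_time_Suc)
qed (simp add: restart_law_def)

end

section \<open>Kernels and product measures\<close>

lemma mixture_eq_bind:
  assumes K: "K \<in> completion \<mu> \<rightarrow>\<^sub>M subprob_algebra N" and \<mu>: "space \<mu> \<noteq> {}"
  shows "mixture N \<mu> K = completion \<mu> \<bind> K"
proof -
  have sets: "sets (completion \<mu> \<bind> K) = sets N" "space (completion \<mu> \<bind> K) = space N"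
    using sets_bind_measurable[OF K] \<mu> by (auto dest: sets_eq_imp_space_eq)
  have "mixture N \<mu> K = measure_of (space N) (sets N) (emeasure (completion \<mu> \<bind> K))"
    unfolding mixture_def
    by (rule measure_of_eq[OF sets.space_closed])
       (use \<mu> in \<open>simp add: sets.sigma_sets_eq emeasure_bind[OF _ K]\<close>)
  also have "\<dots> = completion \<mu> \<bind> K"
    using measure_of_of_measure[of "completion \<mu> \<bind> K"] by (simp add: sets)
  finally show ?thesis .
qed

lemma completion_in_prob_algebra: "prob_space \<mu> \<Longrightarrow> completion \<mu> \<in> space (prob_algebra (completion \<mu>))"
  by (auto simp: space_prob_algebra prob_space.prob_space_completion)

lemma markov_family_kernel:
  assumes P: "markov_family P" and \<mu>: "prob_space \<mu>" "sets \<mu> = sets borel"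
  shows "P \<in> completion \<mu> \<rightarrow>\<^sub>M prob_algebra path_F"
proof (rule measurable_prob_algebraI, goal_cases)
  case (1 x)
  then show ?case using P by (simp add: markov_family_def)
next
  case 2
  have prob: "prob_space (P x)" "sets (P x) = sets path_F" for x
    using P by (auto simp: markov_family_def)
  show ?case
  proof (rule measurable_subprob_algebra)
    fix A :: "'a path set" assume "A \<in> sets path_F"
    then have "(\<lambda>x. measure (P x) A) \<in> borel_measurable (completion \<mu>)"
      using P \<mu> unfolding markov_family_def universally_measurable_def by blast
    then have "(\<lambda>x. ennreal (measure (P x) A)) \<in> borel_measurable (completion \<mu>)" by measurable
    then show "(\<lambda>x. emeasure (P x) A) \<in> borel_measurable (completion \<mu>)"
      using prob_space.finite_measure[OF prob(1)]
      by (simp add: finite_measure.emeasure_eq_measure)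
  qed (use prob in \<open>auto intro: prob_space_imp_subprob_space\<close>)
qed

lemma measure_eqI_rectangles:
  assumes M: "sets M = sets (A \<Otimes>\<^sub>M B)" and N: "sets N = sets (A \<Otimes>\<^sub>M B)" and fin: "finite_measure M"
    and eq: "\<And>a b. a \<in> sets A \<Longrightarrow> b \<in> sets B \<Longrightarrow> emeasure M (a \<times> b) = emeasure N (a \<times> b)"
  shows "M = N"
proof (rule measure_eqI_generator_eq[OF Int_stable_pair_measure_generator pair_measure_closed])
  show "emeasure M X = emeasure N X" if "X \<in> {a \<times> b | a b. a \<in> sets A \<and> b \<in> sets B}" for X
    using that eq by auto
  show "range (\<lambda>i::nat. space A \<times> space B) \<subseteq> {a \<times> b | a b. a \<in> sets A \<and> b \<in> sets B}" by blast
  show "emeasure M (space A \<times> space B) \<noteq> \<infinity>" for i :: nat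
    using finite_measure.emeasure_finite[OF fin] by simp
qed (simp_all add: M N sets_pair_measure)

text \<open>Redrawing one coordinate from its own law leaves the product measure invariant. A single
  coordinate can thus be integrated out without splitting the product into past and future.\<close>

lemma (in product_prob_space) nn_integral_PiM_update:
  assumes k: "k \<in> I" and f: "f \<in> borel_measurable (PiM I M)"
  shows "(\<integral>\<^sup>+ x. f x \<partial>PiM I M) = (\<integral>\<^sup>+ x. \<integral>\<^sup>+ y. f (x(k := y)) \<partial>M k \<partial>PiM I M)"
proof -
  let ?D = "distr (PiM I M \<Otimes>\<^sub>M M k) (PiM I M) (\<lambda>(x, y). x(k := y))"
  have upd: "(\<lambda>(x, y). x(k := y)) \<in> PiM I M \<Otimes>\<^sub>M M k \<rightarrow>\<^sub>M PiM I M"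
    using measurable_add_dim[of k I M] k by (simp add: insert_absorb)
  have "?D = PiM I M"
  proof (rule PiM_eq)
    fix J F assume J: "finite J" "J \<subseteq> I" "\<And>j. j \<in> J \<Longrightarrow> F j \<in> sets (M j)"
    \<comment> \<open>The constraint on the redrawn value; if \<open>k\<close> is not among the
      tested coordinates it is the whole space, of mass 1. The old value at \<open>k\<close> is
      never constrained.\<close>
    define Fk where "Fk = (if k \<in> J then F k else space (M k))"
    have Fk: "Fk \<in> sets (M k)" using J by (auto simp: Fk_def)
    have "(\<lambda>(x, y). x(k := y)) -` prod_emb I M J (Pi\<^sub>E J F) \<inter> space (PiM I M \<Otimes>\<^sub>M M k) =
        {x \<in> space (PiM I M). \<forall>j\<in>J - {k}. x j \<in> F j} \<times> Fk" (is "?L = ?R")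
    proof (intro set_eqI iffI)
      fix z assume z: "z \<in> ?L"
      then have z': "(fst z)(k := snd z) \<in> prod_emb I M J (Pi\<^sub>E J F)"
        "fst z \<in> space (PiM I M)" "snd z \<in> space (M k)" by (auto simp: space_pair_measure)
      then have F: "((fst z)(k := snd z)) j \<in> F j" if "j \<in> J" for j
        using that by (auto simp: prod_emb_def PiE_iff)
      have "snd z \<in> Fk" using F[of k] z'(3) by (simp add: Fk_def)
      moreover have "fst z j \<in> F j" if "j \<in> J - {k}" for j using F[of j] that by simp
      ultimately show "z \<in> ?R" using z' by (simp add: mem_Times_iff)
    next
      fix z assume z: "z \<in> ?R"
      then have z': "fst z \<in> space (PiM I M)" "snd z \<in> space (M k)"
        using sets.sets_into_space[OF Fk] by auto
      then have upd_space: "(fst z)(k := snd z) \<in> space (PiM I M)"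
        using k by (auto simp: space_PiM PiE_iff extensional_def)
      have "((fst z)(k := snd z)) j \<in> F j" if "j \<in> J" for j
        using z that by (auto simp: Fk_def)
      then show "z \<in> ?L" using z' upd_space J(2)
        by (auto simp: prod_emb_def space_pair_measure mem_Times_iff space_PiM case_prod_beta)
    qed
    moreover have "emeasure (PiM I M) {x \<in> space (PiM I M). \<forall>j\<in>J - {k}. x j \<in> F j} =
        (\<Prod>j\<in>J - {k}. emeasure (M j) (F j))"
      using J by (intro emeasure_PiM_Collect) auto
    moreover have "{x \<in> space (PiM I M). \<forall>j\<in>J - {k}. x j \<in> F j} \<in> sets (PiM I M)"
    proof (rule sets.sets_Collect_finite_All)
      fix j assume "j \<in> J - {k}"
      then have "(\<lambda>x. x j) -` F j \<inter> space (PiM I M) \<in> sets (PiM I M)"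
        using J by (intro measurable_sets[OF measurable_component_singleton]) auto
      then show "{x \<in> space (PiM I M). x j \<in> F j} \<in> sets (PiM I M)"
        by (simp add: vimage_def Int_def conj_commute)
    qed (use J in simp)
    ultimately have "emeasure ?D (prod_emb I M J (Pi\<^sub>E J F)) =
        (\<Prod>j\<in>J - {k}. emeasure (M j) (F j)) * emeasure (M k) Fk"
      using J upd Fk by (subst emeasure_distr) (auto intro!: sets_PiM_I simp: M.emeasure_pair_measure_Times)
    also have "\<dots> = (\<Prod>j\<in>J. emeasure (M j) (F j))"
      using J(1) by (cases "k \<in> J") (simp_all add: Fk_def M.emeasure_space_1 prod.remove[of J k] mult.commute)
    finally show "emeasure ?D (prod_emb I M J (Pi\<^sub>E J F)) = (\<Prod>j\<in>J. emeasure (M j) (F j))" .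
  qed simp
  then have "(\<integral>\<^sup>+ x. f x \<partial>PiM I M) = (\<integral>\<^sup>+ x. f x \<partial>?D)" by simp
  also have "\<dots> = (\<integral>\<^sup>+ z. f ((fst z)(k := snd z)) \<partial>(PiM I M \<Otimes>\<^sub>M M k))"
    by (subst nn_integral_distr[OF upd]) (simp_all add: f case_prod_beta)
  also have "\<dots> = (\<integral>\<^sup>+ x. \<integral>\<^sup>+ y. f (x(k := y)) \<partial>M k \<partial>PiM I M)"
    using measurable_compose[OF upd f] by (subst M.nn_integral_fst[symmetric]) (simp_all add: case_prod_beta)
  finally show ?thesis .
qed

text \<open>The factors \<open>a j\<close> need not be probabilities. Testing with whole spaces
  shows that their total values multiply to the mass of \<open>H\<close>, so none of them vanishes;
  dividing by them gives the conditional marginals.\<close>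

lemma (in prob_space) indep_vars_uniform_measure:
  fixes a :: "nat \<Rightarrow> 'c set \<Rightarrow> real"
  assumes X: "\<And>j. j \<le> n \<Longrightarrow> X j \<in> M \<rightarrow>\<^sub>M N" and H: "H \<in> sets M" "emeasure M H > 0"
    and fac: "\<And>C. (\<And>j. j \<le> n \<Longrightarrow> C j \<in> sets N) \<Longrightarrow>
      measure M {w \<in> H. \<forall>j\<le>n. X j w \<in> C j} = (\<Prod>j\<le>n. a j (C j))"
  shows "prob_space.indep_vars (uniform_measure M H) (\<lambda>_. N) X {..n}"
proof -
  let ?U = "uniform_measure M H"
  have H0: "emeasure M H \<noteq> 0" "emeasure M H \<noteq> \<infinity>" using H by auto
  interpret U: prob_space ?U by (rule prob_space_uniform_measure[OF H0])
  have space_N: "X j w \<in> space N" if "j \<le> n" "w \<in> H" for j w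
    using measurable_space[OF X] that sets.sets_into_space[OF H(1)] by auto
  have "{w \<in> H. \<forall>j\<le>n. X j w \<in> space N} = H" using space_N by auto
  then have mH: "measure M H = (\<Prod>j\<le>n. a j (space N))"
    using fac[of "\<lambda>_. space N"] by simp
  moreover have "measure M H \<noteq> 0" using H0 by (simp add: emeasure_eq_measure)
  ultimately have nz: "a j (space N) \<noteq> 0" if "j \<le> n" for j using that by auto
  have joint: "U.prob {w \<in> space M. \<forall>j\<le>n. X j w \<in> C j} = (\<Prod>j\<le>n. a j (C j) / a j (space N))"
    if C: "\<And>j. j \<le> n \<Longrightarrow> C j \<in> sets N" for C
  proof -
    have "{w \<in> space M. \<forall>j\<in>{..n}. X j w \<in> C j} \<in> sets M"
    proof (rule sets.sets_Collect_finite_All)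
      show "{w \<in> space M. X j w \<in> C j} \<in> sets M" if "j \<in> {..n}" for j
        using measurable_sets[OF X C, of j j] that by (simp add: vimage_def Int_def conj_commute)
    qed simp
    then have "{w \<in> space M. \<forall>j\<le>n. X j w \<in> C j} \<in> sets M"
      by (simp only: Ball_def atMost_iff)
    then have "U.prob {w \<in> space M. \<forall>j\<le>n. X j w \<in> C j} =
        measure M (H \<inter> {w \<in> space M. \<forall>j\<le>n. X j w \<in> C j}) / measure M H"
      by (rule measure_uniform_measure[OF H0])
    also have "H \<inter> {w \<in> space M. \<forall>j\<le>n. X j w \<in> C j} = {w \<in> H. \<forall>j\<le>n. X j w \<in> C j}"
      using sets.sets_into_space[OF H(1)] by auto
    also have "measure M {w \<in> H. \<forall>j\<le>n. X j w \<in> C j} = (\<Prod>j\<le>n. a j (C j))"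
      by (rule fac) (rule C)
    finally show ?thesis by (simp add: mH prod_dividef)
  qed
  have single: "U.prob (X i -` D \<inter> space M) = a i D / a i (space N)" if i: "i \<le> n" and D: "D \<in> sets N" for i D
  proof -
    have "X i -` D \<inter> space M = {w \<in> space M. \<forall>j\<le>n. X j w \<in> (if j = i then D else space N)}"
      using i measurable_space[OF X] by auto
    then have "U.prob (X i -` D \<inter> space M) =
        (\<Prod>j\<le>n. a j (if j = i then D else space N) / a j (space N))"
      using joint[of "\<lambda>j. if j = i then D else space N"] D by simp
    also have "\<dots> = (\<Prod>j\<le>n. if j = i then a i D / a i (space N) else 1)"
      by (rule prod.cong) (use nz in auto)
    finally show ?thesis using i by simp
  qed
  show ?thesis unfolding U.indep_vars_def2
  proof (intro conjI ballI)
    fix j assume "j \<in> {..n}"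
    then show "U.random_variable N (X j)"
      using X[of j] by (simp cong: measurable_cong_sets)
  next
    \<comment> \<open>Each family contains the whole space, so the product formula is needed only
      for all indices at once.\<close>
    show "U.indep_sets (\<lambda>i. {X i -` A \<inter> space ?U |A. A \<in> sets N}) {..n}"
    proof (subst U.indep_sets_finite)
      show "\<forall>A\<in>\<Pi> i\<in>{..n}. {X i -` A \<inter> space ?U |A. A \<in> sets N}.
          U.prob (\<Inter>j\<in>{..n}. A j) = (\<Prod>j\<in>{..n}. U.prob (A j))"
      proof
        fix A assume "A \<in> (\<Pi> i\<in>{..n}. {X i -` A \<inter> space ?U |A. A \<in> sets N})"
        then have "\<forall>j. \<exists>C. j \<le> n \<longrightarrow> C \<in> sets N \<and> A j = X j -` C \<inter> space M" by (fastforce simp: Pi_iff)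
        then obtain C where C: "\<And>j. j \<le> n \<Longrightarrow> C j \<in> sets N" "\<And>j. j \<le> n \<Longrightarrow> A j = X j -` C j \<inter> space M"
          by metis
        have "(\<Inter>j\<in>{..n}. A j) = {w \<in> space M. \<forall>j\<le>n. X j w \<in> C j}" using C(2) by auto
        then show "U.prob (\<Inter>j\<in>{..n}. A j) = (\<Prod>j\<in>{..n}. U.prob (A j))"
          using joint[OF C(1)] C by (simp add: single)
      qed
    next
      fix i assume i: "i \<in> {..n}"
      then show "{X i -` A \<inter> space ?U |A. A \<in> sets N} \<subseteq> U.events"
        using measurable_sets[OF X] by auto
      have "space ?U = X i -` space N \<inter> space ?U" using i measurable_space[OF X] by auto
      then show "space ?U \<in> {X i -` A \<inter> space ?U |A. A \<in> sets N}" by blast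
    qed auto
  qed
qed

lemma uniform_measure_full:
  assumes "prob_space M" "H \<in> sets M" "AE x in M. x \<in> H"
  shows "uniform_measure M H = M"
proof (rule measure_eqI)
  interpret prob_space M by fact
  fix A assume "A \<in> sets (uniform_measure M H)"
  then have A: "A \<in> sets M" by simp
  have "emeasure M H = 1" using assms(2,3) by (simp add: emeasure_eq_1_AE)
  moreover have "emeasure M (H \<inter> A) = emeasure M A"
    by (rule emeasure_eq_AE) (use assms A in auto)
  ultimately show "emeasure (uniform_measure M H) A = emeasure M A"
    using assms(2) A by (simp add: divide_ennreal_def)
qed simp

section \<open>The law of the pieces\<close>

locale controlled_cycles = independent_cycles MZ Q \<tau> Z
  for MZ :: "'z measure" and Q :: "'e::polish_space \<times> 'z \<Rightarrow> 'e measure"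
    and \<tau> :: "nat \<Rightarrow> 'e aug \<Rightarrow> ennreal" and Z :: "nat \<Rightarrow> 'e aug \<Rightarrow> 'z" +
  fixes P :: "'e \<Rightarrow> 'e path measure" and ebar :: 'e
  assumes markov: "markov_family P"
    and Q_measurable: "Q \<in> borel \<Otimes>\<^sub>M MZ \<rightarrow>\<^sub>M prob_algebra borel"
begin

lemma mixture_P:
  assumes "prob_space \<mu>" "sets \<mu> = sets borel"
  shows "prob_space (mixture path_F \<mu> P)" "sets (mixture path_F \<mu> P) = sets path_F"
proof -
  note P = markov_family_kernel[OF markov assms]
  have "mixture path_F \<mu> P = completion \<mu> \<bind> P"
    by (rule mixture_eq_bind[OF measurable_prob_algebraD[OF P]])
       (use assms in \<open>auto dest: sets_eq_imp_space_eq\<close>)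
  then show "prob_space (mixture path_F \<mu> P)" "sets (mixture path_F \<mu> P) = sets path_F"
    using prob_space_bind'[OF completion_in_prob_algebra[OF assms(1)] P]
      sets_bind'[OF completion_in_prob_algebra[OF assms(1)] P] by simp_all
qed

lemma restart_prob:
  assumes "1 \<le> k"
  shows "prob_space (restart k)" "sets (restart k) = sets borel"
proof -
  have "restart k \<in> space (prob_algebra borel)"
  proof (cases "\<exists>w\<in>space aug_F. \<tau> k w < \<infinity>")
    case True
    then obtain w where w: "w \<in> space aug_F" "\<tau> k w < \<infinity>" by blast
    have "intervention k w \<in> space (prob_algebra borel)"
      unfolding intervention_def using Z_in_space[OF assms w(1)]
      by (intro measurable_space[OF Q_measurable]) (simp add: space_pair_measure)
    then show ?thesis unfolding restart_eq[OF assms w] .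
  next
    case False
    then have "restart k = return borel undefined" unfolding restart_def by (rule if_not_P)
    then show ?thesis by (simp add: space_prob_algebra prob_space_return)
  qed
  then show "prob_space (restart k)" "sets (restart k) = sets borel"
    by (simp_all add: space_prob_algebra)
qed

text \<open>Indexed by the component before the intervention: \<open>fresh k\<close> is the law of
  piece \<open>k + 1\<close>.\<close>

definition fresh :: "nat \<Rightarrow> 'e path measure" where
  "fresh k = mixture path_F (restart (Suc k)) P"

definition dummy :: "'e path measure" where
  "dummy = mixture path_F (return borel ebar) P"

lemma prob_fresh: "prob_space (fresh k)" and sets_fresh [measurable_cong]: "sets (fresh k) = sets path_F"
  unfolding fresh_def using mixture_P[OF restart_prob, of "Suc k"] by simp_all

lemma prob_dummy: "prob_space dummy" and sets_dummy [measurable_cong]: "sets dummy = sets path_F"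
  unfolding dummy_def using mixture_P[of "return borel ebar"] by (simp_all add: prob_space_return)

lemma space_fresh [simp]: "space (fresh k) = cadlag" and space_dummy [simp]: "space dummy = cadlag"
  using sets_eq_imp_space_eq[OF sets_fresh] sets_eq_imp_space_eq[OF sets_dummy] by simp_all

lemma transition_eq:
  "e \<in> space pieces_G \<Longrightarrow> transition P Q ebar zbar \<tau> Z k e =
    (if pieces_time \<tau> (Suc k) e < \<infinity> then fresh k else dummy)"
  by (simp add: transition_def restart_law_eq fresh_def dummy_def)

lemma emeasure_fresh_dummy:
  assumes "A \<in> sets path_F" "B \<in> sets path_F"
  shows "emeasure (fresh k \<Otimes>\<^sub>M dummy) (A \<times> B) = emeasure (fresh k) A * emeasure dummy B"
proof -
  interpret prob_space dummy by (rule prob_dummy)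
  show ?thesis using assms by (intro emeasure_pair_measure_Times) (simp_all add: sets_fresh sets_dummy)
qed

section \<open>Explicit construction of the pieces from an infinite product\<close>

definition rest :: "(nat \<Rightarrow> 'e path \<times> 'e path) measure" where
  "rest = PiM UNIV (\<lambda>k. fresh k \<Otimes>\<^sub>M dummy)"

sublocale rest: product_prob_space "\<lambda>k. fresh k \<Otimes>\<^sub>M dummy" "UNIV :: nat set"
  by (rule product_prob_spaceI) (rule prob_space_pair[OF prob_fresh prob_dummy])

lemma prob_rest: "prob_space rest"
  unfolding rest_def by (rule rest.P.prob_space_axioms)

lemma sets_rest [measurable_cong]: "sets rest = sets (PiM UNIV (\<lambda>_. path_F \<Otimes>\<^sub>M path_F))"
  unfolding rest_def by (intro sets_PiM_cong sets_pair_measure_cong) (simp_all add: sets_fresh sets_dummy)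

lemma space_rest: "space rest = UNIV \<rightarrow> cadlag \<times> cadlag"
  by (simp add: rest_def space_PiM space_pair_measure PiE_UNIV_domain)

text \<open>The pieces taken as if every intervention happened. Their components are independent,
  whereas those of \<open>switched\<close> obey the prescribed transitions.\<close>

definition chain :: "'e aug \<times> (nat \<Rightarrow> 'e path \<times> 'e path) \<Rightarrow> 'e pieces" where
  "chain z = (fst (fst z), \<lambda>k. case k of 0 \<Rightarrow> snd (fst z) | Suc j \<Rightarrow> fst (snd z j))"

text \<open>\<open>fst (snd z j)\<close> is the piece started by the \<open>(j + 1)\<close>-st intervention, \<open>snd (snd z j)\<close> the dummy
  piece used if that intervention never happens.\<close>

definition switched :: "'e aug \<times> (nat \<Rightarrow> 'e path \<times> 'e path) \<Rightarrow> 'e pieces" where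
  "switched z = (fst (fst z), \<lambda>k. case k of 0 \<Rightarrow> snd (fst z) | Suc j \<Rightarrow>
     if pieces_time \<tau> (Suc j) (chain z) < \<infinity> then fst (snd z j) else snd (snd z j))"

lemma chain_simps [simp]:
  "fst (chain z) = fst (fst z)" "snd (chain z) 0 = snd (fst z)" "snd (chain z) (Suc j) = fst (snd z j)"
  by (simp_all add: chain_def)

lemma switched_simps [simp]:
  "fst (switched z) = fst (fst z)" "snd (switched z) 0 = snd (fst z)"
  "snd (switched z) (Suc j) =
     (if pieces_time \<tau> (Suc j) (chain z) < \<infinity> then fst (snd z j) else snd (snd z j))"
  by (simp_all add: switched_def)

text \<open>The switch alters only pieces that are never reached. This is why it may be decided by
  the times of \<open>chain\<close>, with no recursion through pieces already switched.\<close>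

lemma pasted_switched: "pasted \<tau> (switched z) k = pasted \<tau> (chain z) k"
  by (rule pasted_cong_reached) (simp_all del: infinity_ennreal_def)

lemma pieces_time_switched: "pieces_time \<tau> k (switched z) = pieces_time \<tau> k (chain z)"
  by (cases k) (simp_all add: pieces_time_Suc pasted_switched)

lemma measurable_rest_component:
  "(\<lambda>z. fst (snd z j)) \<in> aug_F \<Otimes>\<^sub>M rest \<rightarrow>\<^sub>M path_F" "(\<lambda>z. snd (snd z j)) \<in> aug_F \<Otimes>\<^sub>M rest \<rightarrow>\<^sub>M path_F"
proof -
  have "(\<lambda>z. snd z j) \<in> aug_F \<Otimes>\<^sub>M rest \<rightarrow>\<^sub>M path_F \<Otimes>\<^sub>M path_F"
    by (rule measurable_compose[OF measurable_snd])
       (simp cong: measurable_cong_sets add: sets_rest measurable_component_singleton)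
  from measurable_compose[OF this measurable_fst] measurable_compose[OF this measurable_snd]
  show "(\<lambda>z. fst (snd z j)) \<in> aug_F \<Otimes>\<^sub>M rest \<rightarrow>\<^sub>M path_F" "(\<lambda>z. snd (snd z j)) \<in> aug_F \<Otimes>\<^sub>M rest \<rightarrow>\<^sub>M path_F"
    by this
qed

lemma measurable_initial:
  "(\<lambda>z. fst (fst z)) \<in> borel_measurable (aug_F \<Otimes>\<^sub>M rest)" "(\<lambda>z. snd (fst z)) \<in> aug_F \<Otimes>\<^sub>M rest \<rightarrow>\<^sub>M path_F"
  using measurable_compose[OF measurable_fst measurable_aug_fst] measurable_compose[OF measurable_fst measurable_aug_snd]
  by blast+

lemma measurable_chain [measurable]: "chain \<in> aug_F \<Otimes>\<^sub>M rest \<rightarrow>\<^sub>M pieces_G"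
proof (rule measurable_pieces_GI)
  show "(\<lambda>z. snd (chain z) k) \<in> aug_F \<Otimes>\<^sub>M rest \<rightarrow>\<^sub>M path_F" for k
    using measurable_rest_component(1) measurable_initial(2) by (cases k) simp_all
qed (use measurable_initial(1) in simp)

lemmas measurable_time [measurable] = measurable_pieces_time[OF measurable_tau]

lemma measurable_switched [measurable]: "switched \<in> aug_F \<Otimes>\<^sub>M rest \<rightarrow>\<^sub>M pieces_G"
proof (rule measurable_pieces_GI)
  have [measurable]: "Measurable.pred (aug_F \<Otimes>\<^sub>M rest) (\<lambda>z. pieces_time \<tau> k (chain z) < \<infinity>)" for k
    by measurable
  show "(\<lambda>z. snd (switched z) k) \<in> aug_F \<Otimes>\<^sub>M rest \<rightarrow>\<^sub>M path_F" for k
  proof (cases k)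
    case (Suc j)
    have "(\<lambda>z. if pieces_time \<tau> (Suc j) (chain z) < \<infinity> then fst (snd z j) else snd (snd z j))
        \<in> aug_F \<Otimes>\<^sub>M rest \<rightarrow>\<^sub>M path_F"
      by (intro measurable_If measurable_rest_component) measurable
    then show ?thesis unfolding Suc switched_simps .
  qed (use measurable_initial(2) in simp)
qed (use measurable_initial(1) in simp)

definition pieces_law :: "'e aug measure \<Rightarrow> 'e pieces measure" where
  "pieces_law I = distr (I \<Otimes>\<^sub>M rest) pieces_G switched"

definition first_space :: "nat \<Rightarrow> 'e pieces measure" where
  "first_space k = borel \<Otimes>\<^sub>M PiM {..k} (\<lambda>_. path_F)"

definition first :: "nat \<Rightarrow> 'e pieces \<Rightarrow> 'e pieces" where
  "first k e = (fst e, restrict (snd e) {..k})"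

lemma measurable_first [measurable]: "first k \<in> pieces_G \<rightarrow>\<^sub>M first_space k"
  unfolding first_def[abs_def] first_space_def pieces_G_def by measurable

text \<open>To test component \<open>k + 1\<close>, coordinate \<open>k\<close> of
  \<open>rest\<close> is redrawn and integrated out; everything that decides which law applies is
  unaffected by the redrawing.\<close>

lemma pieces_law_transitions:
  assumes I: "prob_space I" "sets I = sets aug_F"
  shows "has_transitions I (transition P Q ebar zbar \<tau> Z) (pieces_law I)"
proof -
  interpret I: prob_space I by fact
  interpret rest': prob_space rest by (rule prob_rest)
  interpret J: pair_prob_space I rest ..
  have sw [measurable]: "switched \<in> I \<Otimes>\<^sub>M rest \<rightarrow>\<^sub>M pieces_G"
    using measurable_switched by (simp cong: measurable_cong_sets add: sets_pair_measure_cong[OF I(2) refl])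
  have space_I: "space I = UNIV \<times> cadlag"
    using sets_eq_imp_space_eq[OF I(2)] by (simp add: space_aug_F)
  have sets: "sets (pieces_law I) = sets pieces_G" by (simp add: pieces_law_def)
  have init [measurable]: "(\<lambda>e. (fst e, snd e 0)) \<in> pieces_G \<rightarrow>\<^sub>M (aug_F :: 'e aug measure)"
    by (rule measurable_aug_FI) simp_all
  have "distr (pieces_law I) aug_F (\<lambda>e. (fst e, snd e 0)) = distr (I \<Otimes>\<^sub>M rest) aug_F fst"
    unfolding pieces_law_def by (subst distr_distr) (simp_all add: comp_def init sw)
  also have "\<dots> = distr (I \<Otimes>\<^sub>M rest) I fst" by (rule distr_cong) (simp_all add: I)
  also have "\<dots> = I" by (rule rest'.distr_pair_fst)
  finally have initial: "distr (pieces_law I) aug_F (\<lambda>e. (fst e, snd e 0)) = I" .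
  have step: "emeasure (pieces_law I) {e \<in> space (pieces_law I). first k e \<in> A \<and> snd e (Suc k) \<in> B} =
      (\<integral>\<^sup>+ e. indicator A (first k e) * emeasure (transition P Q ebar zbar \<tau> Z k e) B \<partial>completion (pieces_law I))"
    if A [measurable]: "A \<in> sets (first_space k)" and B [measurable]: "B \<in> sets path_F" for k A B
  proof -
    define Ev where "Ev = {e \<in> space pieces_G. first k e \<in> A \<and> snd e (Suc k) \<in> B}"
    have Ev [measurable]: "Ev \<in> sets pieces_G" unfolding Ev_def by measurable
    \<comment> \<open>The integrand of the kernel identity, with \<open>transition\<close> replaced
      by its two possible values so that it is measurable on \<open>pieces_G\<close> itself.\<close>
    define G where "G e = indicator A (first k e) *
      (if pieces_time \<tau> (Suc k) e < \<infinity> then emeasure (fresh k) B else emeasure dummy B)" for e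
    have G [measurable]: "G \<in> borel_measurable pieces_G" unfolding G_def[abs_def] by measurable
    \<comment> \<open>The pieces up to \<open>k\<close> and the time that decides the switch ignore
      \<open>p\<close>; one half of \<open>p\<close> is tested against \<open>B\<close>, the other
      integrates to 1.\<close>
    have inner: "(\<integral>\<^sup>+ p. indicator Ev (switched (w, r(k := p))) \<partial>(fresh k \<Otimes>\<^sub>M dummy)) = G (switched (w, r))"
      if w: "w \<in> space I" and r: "r \<in> space rest" for w r
    proof -
      define T where "T = pieces_time \<tau> (Suc k) (chain (w, r))"
      \<comment> \<open>Component \<open>i + 1\<close> reads coordinate \<open>i\<close> of
        \<open>rest\<close>, so a change at \<open>k\<close> is first felt in component
        \<open>k + 1\<close>.\<close>
      have chain_upd: "pasted \<tau> (chain (w, r(k := p))) j = pasted \<tau> (chain (w, r)) j" if "j \<le> k" for p j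
      proof (rule pasted_cong_upto)
        show "snd (chain (w, r(k := p))) i = snd (chain (w, r)) i" if "i \<le> j" for i
          using that \<open>j \<le> k\<close> by (cases i) auto
      qed simp
      then have T_upd: "pieces_time \<tau> (Suc j) (chain (w, r(k := p))) = pieces_time \<tau> (Suc j) (chain (w, r))"
        if "j \<le> k" for p j using that by (simp add: pieces_time_Suc)
      have sw_upd: "snd (switched (w, r(k := p))) i = snd (switched (w, r)) i" if "i \<le> k" for p i
        using that T_upd by (cases i) auto
      have "restrict (snd (switched (w, r(k := p)))) {..k} = restrict (snd (switched (w, r))) {..k}" for p
        by (rule restrict_ext, rule sw_upd) simp
      then have first_upd: "first k (switched (w, r(k := p))) = first k (switched (w, r))" for p
        by (simp add: first_def)
      have next_upd: "snd (switched (w, r(k := p))) (Suc k) = (if T < \<infinity> then fst p else snd p)" for p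
        using T_upd[of k p] by (simp add: T_def)
      have in_space: "switched (w, r(k := p)) \<in> space pieces_G" if "p \<in> cadlag \<times> cadlag" for p
        by (rule measurable_space[OF sw]) (use w r that in \<open>auto simp: space_pair_measure space_rest Pi_iff\<close>)
      have "(\<integral>\<^sup>+ p. indicator Ev (switched (w, r(k := p))) \<partial>(fresh k \<Otimes>\<^sub>M dummy)) =
          (\<integral>\<^sup>+ p. indicator A (first k (switched (w, r))) *
            indicator (if T < \<infinity> then B \<times> cadlag else cadlag \<times> B) p \<partial>(fresh k \<Otimes>\<^sub>M dummy))"
      proof (rule nn_integral_cong)
        fix p assume "p \<in> space (fresh k \<Otimes>\<^sub>M dummy)"
        then have p: "p \<in> cadlag \<times> cadlag" by (simp add: space_pair_measure)
        then show "indicator Ev (switched (w, r(k := p))) =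
            (indicator A (first k (switched (w, r))) * indicator (if T < \<infinity> then B \<times> cadlag else cadlag \<times> B) p :: ennreal)"
          using in_space[OF p] next_upd[of p]
          by (auto simp: Ev_def first_upd indicator_def mem_Times_iff simp del: switched_simps)
      qed
      also have "\<dots> = indicator A (first k (switched (w, r))) *
          emeasure (fresh k \<Otimes>\<^sub>M dummy) (if T < \<infinity> then B \<times> cadlag else cadlag \<times> B)"
      proof (rule nn_integral_cmult_indicator)
        show "(if T < \<infinity> then B \<times> cadlag else cadlag \<times> B) \<in> sets (fresh k \<Otimes>\<^sub>M dummy)"
          using B by (auto simp: sets_fresh sets_dummy intro!: pair_measureI)
      qed
      also have "emeasure (fresh k \<Otimes>\<^sub>M dummy) (if T < \<infinity> then B \<times> cadlag else cadlag \<times> B) =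
          (if T < \<infinity> then emeasure (fresh k) B else emeasure dummy B)"
        using prob_space.emeasure_space_1[OF prob_dummy]
          prob_space.emeasure_space_1[OF prob_fresh, of k]
        by (simp add: emeasure_fresh_dummy B)
      finally show ?thesis by (simp only: G_def T_def pieces_time_switched)
    qed
    have "emeasure (pieces_law I) {e \<in> space (pieces_law I). first k e \<in> A \<and> snd e (Suc k) \<in> B} =
        emeasure (pieces_law I) Ev" by (simp add: Ev_def pieces_law_def)
    also have "\<dots> = (\<integral>\<^sup>+ e. indicator Ev e \<partial>pieces_law I)"
      by (rule nn_integral_indicator[symmetric]) (simp add: sets)
    also have "\<dots> = (\<integral>\<^sup>+ z. indicator Ev (switched z) \<partial>(I \<Otimes>\<^sub>M rest))"
      unfolding pieces_law_def by (rule nn_integral_distr[OF sw]) simp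
    also have "\<dots> = (\<integral>\<^sup>+ w. \<integral>\<^sup>+ r. indicator Ev (switched (w, r)) \<partial>rest \<partial>I)"
      by (rule rest'.nn_integral_fst[symmetric]) simp
    also have "\<dots> = (\<integral>\<^sup>+ w. \<integral>\<^sup>+ r. G (switched (w, r)) \<partial>rest \<partial>I)"
    proof (rule nn_integral_cong)
      fix w assume w: "w \<in> space I"
      have "(\<lambda>r. indicator Ev (switched (w, r)) :: ennreal) \<in> borel_measurable rest"
        using w by measurable
      then have "(\<integral>\<^sup>+ r. indicator Ev (switched (w, r)) \<partial>rest) =
          (\<integral>\<^sup>+ r. \<integral>\<^sup>+ p. indicator Ev (switched (w, r(k := p))) \<partial>(fresh k \<Otimes>\<^sub>M dummy) \<partial>rest)"
        unfolding rest_def by (intro rest.nn_integral_PiM_update) simp_all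
      also have "\<dots> = (\<integral>\<^sup>+ r. G (switched (w, r)) \<partial>rest)"
        by (rule nn_integral_cong) (rule inner[OF w])
      finally show "(\<integral>\<^sup>+ r. indicator Ev (switched (w, r)) \<partial>rest) = (\<integral>\<^sup>+ r. G (switched (w, r)) \<partial>rest)" .
    qed
    also have "\<dots> = (\<integral>\<^sup>+ z. G (switched z) \<partial>(I \<Otimes>\<^sub>M rest))"
      by (rule rest'.nn_integral_fst) simp
    also have "\<dots> = (\<integral>\<^sup>+ e. G e \<partial>pieces_law I)"
      unfolding pieces_law_def by (rule nn_integral_distr[OF sw, symmetric]) simp
    also have "\<dots> = (\<integral>\<^sup>+ e. indicator A (first k e) * emeasure (transition P Q ebar zbar \<tau> Z k e) B \<partial>pieces_law I)"
      by (rule nn_integral_cong) (simp add: G_def transition_eq pieces_law_def)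
    finally show ?thesis by (simp add: nn_integral_completion)
  qed
  have "prob_space (pieces_law I)"
    unfolding pieces_law_def by (rule J.prob_space_distr[OF sw])
  then show ?thesis
    unfolding has_transitions_def using sets initial step[unfolded first_def first_space_def] by blast
qed

section \<open>Uniqueness of the law of the pieces\<close>

text \<open>Pads with constant paths, so that the time \<open>k + 1\<close>, a function of all
  pieces that uses only components \<open>0\<close> to \<open>k\<close>, can be evaluated on those
  components alone.\<close>

definition extend :: "nat \<Rightarrow> 'e pieces \<Rightarrow> 'e pieces" where
  "extend k h = (fst h, \<lambda>i. if i \<le> k then snd h i else (\<lambda>t\<in>{0..}. ebar))"

lemma measurable_first_space:
  "fst \<in> borel_measurable (first_space k)" "i \<le> k \<Longrightarrow> (\<lambda>h. snd h i) \<in> first_space k \<rightarrow>\<^sub>M path_F"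
  unfolding first_space_def
  by (simp, rule measurable_compose[OF measurable_snd measurable_component_singleton]) simp

lemma measurable_extend [measurable]: "extend k \<in> first_space k \<rightarrow>\<^sub>M pieces_G"
proof (rule measurable_pieces_GI)
  show "(\<lambda>h. snd (extend k h) i) \<in> first_space k \<rightarrow>\<^sub>M path_F" for i
    using measurable_first_space(2)[of i k] by (cases "i \<le> k") (simp_all add: extend_def cadlag_const)
qed (simp add: extend_def measurable_first_space)

lemma pieces_time_extend: "pieces_time \<tau> (Suc k) (extend k (first k e)) = pieces_time \<tau> (Suc k) e"
proof -
  have "pasted \<tau> (extend k (first k e)) k = pasted \<tau> e k"
    by (rule pasted_cong_upto) (simp_all add: extend_def first_def)
  then show ?thesis by (simp add: pieces_time_Suc)
qed

text \<open>Writes the kernel identity as an integral against the law of components \<open>0\<close>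
  to \<open>k\<close>, so that equality of these laws carries over to the next component.\<close>

lemma has_transitions_step:
  assumes "has_transitions I (transition P Q ebar zbar \<tau> Z) M"
    and A: "A \<in> sets (first_space k)" and B: "B \<in> sets path_F"
  shows "emeasure M {e \<in> space pieces_G. first k e \<in> A \<and> snd e (Suc k) \<in> B} =
    (\<integral>\<^sup>+ h. indicator A h * (if pieces_time \<tau> (Suc k) (extend k h) < \<infinity> then emeasure (fresh k) B
       else emeasure dummy B) \<partial>distr M (first_space k) (first k))" (is "_ = (\<integral>\<^sup>+ h. ?\<phi> h \<partial>_)")
proof -
  note [measurable] = A
  have M: "sets M = sets pieces_G" "space M = space pieces_G"
    using assms(1) sets_eq_imp_space_eq[of M pieces_G] by (auto simp: has_transitions_def)
  have "emeasure M {e \<in> space M. first k e \<in> A \<and> snd e (Suc k) \<in> B} =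
      (\<integral>\<^sup>+ e. indicator A (first k e) * emeasure (transition P Q ebar zbar \<tau> Z k e) B \<partial>completion M)"
    using assms(1) A B unfolding has_transitions_def first_def first_space_def by blast
  also have "\<dots> = (\<integral>\<^sup>+ e. indicator A (first k e) * emeasure (transition P Q ebar zbar \<tau> Z k e) B \<partial>M)"
    by (rule nn_integral_completion)
  also have "\<dots> = (\<integral>\<^sup>+ e. ?\<phi> (first k e) \<partial>M)"
    by (rule nn_integral_cong) (simp add: M transition_eq pieces_time_extend)
  also have "\<dots> = (\<integral>\<^sup>+ h. ?\<phi> h \<partial>distr M (first_space k) (first k))"
  proof (rule nn_integral_distr[symmetric])
    show "first k \<in> M \<rightarrow>\<^sub>M first_space k" using measurable_first by (simp cong: measurable_cong_sets add: M)
  qed simp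
  finally show ?thesis by (simp add: M)
qed

text \<open>Induction on \<open>k\<close>: the law of the components so far fixes the mass of every
  rectangle with the next component, and rectangles determine the joint law.\<close>

lemma has_transitions_first_unique:
  assumes M: "has_transitions I (transition P Q ebar zbar \<tau> Z) M"
    and M': "has_transitions I (transition P Q ebar zbar \<tau> Z) M'"
  shows "distr M (first_space k) (first k) = distr M' (first_space k) (first k)"
proof (induction k)
  case 0
  define g :: "'e aug \<Rightarrow> 'e pieces" where "g w = (fst w, \<lambda>i\<in>{..0}. snd w)" for w
  have g: "g \<in> aug_F \<rightarrow>\<^sub>M first_space 0"
    unfolding g_def[abs_def] first_space_def by measurable
  have init: "(\<lambda>e. (fst e, snd e 0)) \<in> pieces_G \<rightarrow>\<^sub>M (aug_F :: 'e aug measure)"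
    by (rule measurable_aug_FI) simp_all
  have "distr N (first_space 0) (first 0) = distr I (first_space 0) g"
    if N: "has_transitions I (transition P Q ebar zbar \<tau> Z) N" for N
  proof -
    have init: "(\<lambda>e. (fst e, snd e 0)) \<in> N \<rightarrow>\<^sub>M (aug_F :: 'e aug measure)"
      using N init by (simp cong: measurable_cong_sets add: has_transitions_def)
    have I: "I = distr N aug_F (\<lambda>e. (fst e, snd e 0))" using N by (simp add: has_transitions_def)
    have "g \<circ> (\<lambda>e. (fst e, snd e 0)) = first 0"
      by (auto simp: g_def first_def fun_eq_iff restrict_def)
    then show ?thesis unfolding I by (subst distr_distr[OF g init]) simp
  qed
  then show ?case using M M' by simp
next
  case (Suc k)
  let ?H = "first_space k \<Otimes>\<^sub>M (path_F :: 'e path measure)"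
  define g :: "'e pieces \<times> 'e path \<Rightarrow> 'e pieces" where
    "g z = (fst (fst z), \<lambda>i\<in>{..Suc k}. if i \<le> k then snd (fst z) i else snd z)" for z
  have g: "g \<in> ?H \<rightarrow>\<^sub>M first_space (Suc k)"
    unfolding first_space_def[of "Suc k"]
  proof (rule measurable_pair)
    have "(\<lambda>z. if i \<le> k then snd (fst z) i else snd z) \<in> ?H \<rightarrow>\<^sub>M path_F" for i
      using measurable_compose[OF measurable_fst measurable_first_space(2)[of i k]]
      by (cases "i \<le> k") simp_all
    then show "snd \<circ> g \<in> ?H \<rightarrow>\<^sub>M PiM {..Suc k} (\<lambda>_. path_F)"
      by (simp add: g_def comp_def measurable_restrict)
    show "fst \<circ> g \<in> ?H \<rightarrow>\<^sub>M borel"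
      using measurable_compose[OF measurable_fst measurable_first_space(1)] by (simp add: g_def comp_def)
  qed
  define f where "f e = (first k e, snd e (Suc k))" for e :: "'e pieces"
  have f: "f \<in> pieces_G \<rightarrow>\<^sub>M ?H" unfolding f_def[abs_def] by measurable
  have gf: "g \<circ> f = first (Suc k)"
    by (auto simp: g_def f_def first_def fun_eq_iff restrict_def le_Suc_eq)
  have rect: "emeasure (distr N ?H f) (a \<times> b) =
      emeasure N {e \<in> space pieces_G. first k e \<in> a \<and> snd e (Suc k) \<in> b}"
    if N: "has_transitions I (transition P Q ebar zbar \<tau> Z) N"
      and ab: "a \<in> sets (first_space k)" "b \<in> sets path_F" for N a b
  proof -
    have sets: "sets N = sets pieces_G" using N by (simp add: has_transitions_def)
    show ?thesis using f ab sets_eq_imp_space_eq[OF sets]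
      by (subst emeasure_distr) (auto simp: f_def sets cong: measurable_cong_sets intro!: arg_cong[where f="emeasure N"])
  qed
  have "distr M ?H f = distr M' ?H f"
  proof (rule measure_eqI_rectangles)
    have "prob_space M" "f \<in> M \<rightarrow>\<^sub>M ?H" using M f by (simp_all add: has_transitions_def cong: measurable_cong_sets)
    then show "finite_measure (distr M ?H f)"
      by (intro prob_space.finite_measure prob_space.prob_space_distr)
    show "emeasure (distr M ?H f) (a \<times> b) = emeasure (distr M' ?H f) (a \<times> b)"
      if "a \<in> sets (first_space k)" "b \<in> sets path_F" for a b
      using that by (simp add: rect[OF M] rect[OF M'] has_transitions_step[OF M] has_transitions_step[OF M'] Suc)
  qed simp_all
  then have "distr (distr M ?H f) (first_space (Suc k)) g = distr (distr M' ?H f) (first_space (Suc k)) g" by simp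
  moreover have "distr (distr N ?H f) (first_space (Suc k)) g = distr N (first_space (Suc k)) (first (Suc k))"
    if "has_transitions I (transition P Q ebar zbar \<tau> Z) N" for N
    using f that by (subst distr_distr[OF g]) (simp_all add: gf has_transitions_def cong: measurable_cong_sets)
  ultimately show ?case using M M' by simp
qed

lemma has_transitions_unique:
  assumes M: "has_transitions I (transition P Q ebar zbar \<tau> Z) M"
    and M': "has_transitions I (transition P Q ebar zbar \<tau> Z) M'"
  shows "M = M'"
proof -
  have sets: "sets N = sets pieces_G" "space N = space pieces_G" "prob_space N" "first k \<in> N \<rightarrow>\<^sub>M first_space k"
    if "has_transitions I (transition P Q ebar zbar \<tau> Z) N" for N k
    using that sets_eq_imp_space_eq[of N pieces_G]
    by (auto simp: has_transitions_def cong: measurable_cong_sets)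
  let ?PI = "PiM UNIV (\<lambda>_::nat. path_F :: 'e path measure)"
  show ?thesis
  proof (rule measure_eqI_rectangles)
    show "sets M = sets (borel \<Otimes>\<^sub>M ?PI)" "sets M' = sets (borel \<Otimes>\<^sub>M ?PI)"
      using sets[OF M] sets[OF M'] by (simp_all add: pieces_G_def)
    show "finite_measure M" using sets(3)[OF M] by (rule prob_space.finite_measure)
    fix a :: "'e set" and b assume a: "a \<in> sets borel" and b: "b \<in> sets ?PI"
    \<comment> \<open>With the value at \<open>0-\<close> confined to \<open>a\<close>, what remains
      is a finite measure on the sequence space, to which uniqueness on cylinders of an infinite
      product applies.\<close>
    define slice where "slice N = distr (density N (indicator (a \<times> UNIV))) ?PI snd" for N :: "'e pieces measure"
    have a': "(a \<times> UNIV) \<inter> space pieces_G \<in> sets pieces_G"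
    proof -
      have "fst -` a \<inter> space pieces_G \<in> sets (pieces_G :: 'e pieces measure)"
        by (rule measurable_sets[OF measurable_pieces_fst a])
      then show ?thesis by (simp add: vimage_fst)
    qed
    have slice: "emeasure (slice N) X = emeasure N (a \<times> X)"
      if N: "has_transitions I (transition P Q ebar zbar \<tau> Z) N" and X: "X \<in> sets ?PI" for N X
    proof -
      have snd: "snd \<in> N \<rightarrow>\<^sub>M ?PI" using sets(1)[OF N] by (simp add: pieces_G_def cong: measurable_cong_sets)
      have ind: "(indicator (a \<times> UNIV) :: _ \<Rightarrow> ennreal) \<in> borel_measurable N"
        using a' sets(1,2)[OF N] by (simp add: borel_measurable_indicator_iff)
      have pre: "snd -` X \<inter> space N \<in> sets N" by (rule measurable_sets[OF snd X])
      have "emeasure (slice N) X = emeasure (density N (indicator (a \<times> UNIV))) (snd -` X \<inter> space N)"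
        unfolding slice_def using snd X by (subst emeasure_distr) simp_all
      also have "\<dots> = (\<integral>\<^sup>+ e. indicator (a \<times> X) e \<partial>N)"
        unfolding emeasure_density[OF ind pre]
        by (rule nn_integral_cong) (auto simp: indicator_def)
      also have "\<dots> = emeasure N (a \<times> X)"
        using a X sets(1)[OF N] by (intro nn_integral_indicator) (simp add: pieces_G_def)
      finally show ?thesis .
    qed
    have "slice M = slice M'"
    proof (rule measure_eqI_PiM_infinite)
      have "emeasure (slice M) (space (slice M)) \<le> 1"
        using slice[OF M, of "space ?PI"] prob_space.emeasure_le_1[OF sets(3)[OF M]]
        by (simp add: slice_def)
      then show "finite_measure (slice M)" by (intro finite_measureI) (auto simp: top_unique)
      fix F :: "nat \<Rightarrow> 'e path set" and J :: "nat set" assume J: "finite J" "J \<subseteq> UNIV" "\<And>i. i \<in> J \<Longrightarrow> F i \<in> sets path_F"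
      \<comment> \<open>A cylinder tests finitely many pieces, so it is an event about components
        \<open>0\<close> to \<open>k\<close> for some \<open>k\<close>.\<close>
      obtain k where k: "J \<subseteq> {..k}" using J(1) finite_nat_iff_bounded_le by blast
      define X where "X = prod_emb UNIV (\<lambda>_. path_F) J (Pi\<^sub>E J F)"
      have X: "X \<in> sets ?PI" unfolding X_def using J by (intro sets_PiM_I) auto
      let ?Y = "a \<times> prod_emb {..k} (\<lambda>_. path_F) J (Pi\<^sub>E J F)"
      have Y: "?Y \<in> sets (first_space k)"
        unfolding first_space_def using J k a by (intro pair_measureI sets_PiM_I) auto
      have "emeasure N (a \<times> X) = emeasure (distr N (first_space k) (first k)) ?Y"
        if N: "has_transitions I (transition P Q ebar zbar \<tau> Z) N" for N
      proof -
        have "first k -` ?Y \<inter> space N = a \<times> X"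
          using k by (auto simp: sets(2)[OF N] first_def X_def prod_emb_def space_pieces_G space_PiM PiE_iff Pi_iff)
              (metis atMost_iff subsetD)
        then show ?thesis using sets(4)[OF N] Y by (simp add: emeasure_distr)
      qed
      then show "emeasure (slice M) (prod_emb UNIV (\<lambda>_. path_F) J (Pi\<^sub>E J F)) =
          emeasure (slice M') (prod_emb UNIV (\<lambda>_. path_F) J (Pi\<^sub>E J F))"
        using slice[OF M X] slice[OF M' X] M M' has_transitions_first_unique[OF M M']
        by (simp add: X_def)
    qed (simp_all add: slice_def)
    then show "emeasure M (a \<times> b) = emeasure M' (a \<times> b)"
      using slice[OF M b] slice[OF M' b] by simp
  qed
qed

section \<open>The law of the cycles\<close>

lemma P_prob: "prob_space (P x)" "sets (P x) = sets path_F"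
  using markov by (simp_all add: markov_family_def)

lemma aug_P_prob: "prob_space (aug_P P x)" "sets (aug_P P x) = sets aug_F"
  unfolding aug_P_def aug_F_def
  by (intro prob_space_pair prob_space_return P_prob) (simp_all cong: sets_pair_measure_cong add: P_prob)

lemma pieces_P_eq: "pieces_P P Q ebar zbar \<tau> Z x = pieces_law (aug_P P x)"
  unfolding pieces_P_def
  using pieces_law_transitions[OF aug_P_prob] has_transitions_unique by blast

definition outcome :: "'e aug \<times> (nat \<Rightarrow> 'e path \<times> 'e path) \<Rightarrow> 'e aug" where
  "outcome z = controlled ebar \<tau> (switched z)"

lemma measurable_outcome [measurable]: "outcome \<in> aug_F \<Otimes>\<^sub>M rest \<rightarrow>\<^sub>M aug_F"
  unfolding outcome_def[abs_def] by measurable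

lemma measurable_pair_rest:
  assumes "sets I = sets aug_F"
  shows "measurable (I \<Otimes>\<^sub>M rest) N = measurable (aug_F \<Otimes>\<^sub>M rest) N"
  by (intro measurable_cong_sets sets_pair_measure_cong assms refl)

lemma controlled_P_eq:
  "controlled_P P Q ebar zbar \<tau> Z x = distr (aug_P P x \<Otimes>\<^sub>M rest) aug_F outcome"
  unfolding controlled_P_def pieces_P_eq pieces_law_def outcome_def[abs_def]
  by (subst distr_distr) (simp_all add: comp_def measurable_pair_rest[OF aug_P_prob(2)])

section \<open>Random initial state\<close>

context
  fixes \<nu> :: "'e measure"
  assumes \<nu>: "prob_space \<nu>" "sets \<nu> = sets borel"
begin

definition initial :: "'e aug measure" where
  "initial = completion \<nu> \<bind> aug_P P"

lemma aug_P_kernel: "aug_P P \<in> completion \<nu> \<rightarrow>\<^sub>M prob_algebra aug_F"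
  unfolding aug_P_def[abs_def] aug_F_def
proof (rule measurable_pair_prob)
  have "(\<lambda>x. x) \<in> completion \<nu> \<rightarrow>\<^sub>M borel"
    using \<nu>(2) by (intro measurable_completion) (simp cong: measurable_cong_sets)
  from measurable_compose[OF this measurable_return_prob_space]
  show "return borel \<in> completion \<nu> \<rightarrow>\<^sub>M prob_algebra borel" by simp
qed (rule markov_family_kernel[OF markov \<nu>])

lemma initial_prob: "prob_space initial" and sets_initial: "sets initial = sets aug_F"
  unfolding initial_def
  using prob_space_bind'[OF completion_in_prob_algebra[OF \<nu>(1)] aug_P_kernel]
    sets_bind'[OF completion_in_prob_algebra[OF \<nu>(1)] aug_P_kernel] by simp_all

lemma sets_initial_rest: "sets (initial \<Otimes>\<^sub>M rest) = sets (aug_F \<Otimes>\<^sub>M rest)"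
  by (rule sets_pair_measure_cong[OF sets_initial refl])

lemma space_nu: "space (completion \<nu>) \<noteq> {}"
  using prob_space.not_empty[OF \<nu>(1)] by simp

lemma joint_kernel: "(\<lambda>x. aug_P P x \<Otimes>\<^sub>M rest) \<in> completion \<nu> \<rightarrow>\<^sub>M prob_algebra (aug_F \<Otimes>\<^sub>M rest)"
  by (rule measurable_pair_prob[OF aug_P_kernel]) (simp add: space_prob_algebra prob_rest)

text \<open>The restart laws do not depend on the starting point \<open>x\<close>, so mixing over
  \<open>x\<close> acts on the first factor only and the result is again a product measure.\<close>

lemma initial_rest: "initial \<Otimes>\<^sub>M rest = completion \<nu> \<bind> (\<lambda>x. aug_P P x \<Otimes>\<^sub>M rest)"
proof (rule measure_eqI)
  interpret rest': prob_space rest by (rule prob_rest)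
  note K = measurable_prob_algebraD[OF joint_kernel] and aug = measurable_prob_algebraD[OF aug_P_kernel]
  show sets: "sets (initial \<Otimes>\<^sub>M rest) = sets (completion \<nu> \<bind> (\<lambda>x. aug_P P x \<Otimes>\<^sub>M rest))"
    using sets_bind_measurable[OF K space_nu] sets_initial_rest by simp
  fix A assume "A \<in> sets (initial \<Otimes>\<^sub>M rest)"
  then have A: "A \<in> sets (aug_F \<Otimes>\<^sub>M rest)" using sets_initial_rest by simp
  have "emeasure (initial \<Otimes>\<^sub>M rest) A = (\<integral>\<^sup>+ w. emeasure rest (Pair w -` A) \<partial>initial)"
    using A sets_initial_rest by (intro rest'.emeasure_pair_measure_alt) simp
  also have "\<dots> = (\<integral>\<^sup>+ x. \<integral>\<^sup>+ w. emeasure rest (Pair w -` A) \<partial>aug_P P x \<partial>completion \<nu>)"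
    unfolding initial_def by (rule nn_integral_bind[OF rest'.measurable_emeasure_Pair[OF A] aug])
  also have "\<dots> = (\<integral>\<^sup>+ x. emeasure (aug_P P x \<Otimes>\<^sub>M rest) A \<partial>completion \<nu>)"
    using A by (intro nn_integral_cong rest'.emeasure_pair_measure_alt[symmetric])
      (simp add: sets_pair_measure_cong[OF aug_P_prob(2) refl[of "sets rest"]])
  also have "\<dots> = emeasure (completion \<nu> \<bind> (\<lambda>x. aug_P P x \<Otimes>\<^sub>M rest)) A"
    by (rule emeasure_bind[OF space_nu K A, symmetric])
  finally show "emeasure (initial \<Otimes>\<^sub>M rest) A = emeasure (completion \<nu> \<bind> (\<lambda>x. aug_P P x \<Otimes>\<^sub>M rest)) A" .
qed

lemma controlled_P_init_eq:
  "controlled_P_init P Q ebar zbar \<tau> Z \<nu> = distr (initial \<Otimes>\<^sub>M rest) aug_F outcome"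
proof -
  have K: "(\<lambda>x. distr (aug_P P x \<Otimes>\<^sub>M rest) aug_F outcome) \<in> completion \<nu> \<rightarrow>\<^sub>M prob_algebra aug_F"
    by (rule measurable_compose[OF joint_kernel measurable_distr_prob_space[OF measurable_outcome]])
  have "controlled_P_init P Q ebar zbar \<tau> Z \<nu> =
      completion \<nu> \<bind> (\<lambda>x. distr (aug_P P x \<Otimes>\<^sub>M rest) aug_F outcome)"
    unfolding controlled_P_init_def controlled_P_eq[abs_def]
    by (rule mixture_eq_bind[OF measurable_prob_algebraD[OF K]]) (use space_nu in simp)
  also have "\<dots> = distr (initial \<Otimes>\<^sub>M rest) aug_F outcome"
    unfolding initial_rest
    by (rule distr_bind[symmetric, OF measurable_prob_algebraD[OF joint_kernel] space_nu measurable_outcome])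
  finally show ?thesis .
qed

lemma AE_nonaccumulating:
  assumes "nonaccumulating P Q ebar zbar \<tau> Z"
  shows "AE z in initial \<Otimes>\<^sub>M rest. (\<lambda>k. pieces_time \<tau> k (switched z)) \<longlonglongrightarrow> \<infinity>"
proof -
  have "AE z in aug_P P x \<Otimes>\<^sub>M rest. (\<lambda>k. pieces_time \<tau> k (switched z)) \<longlonglongrightarrow> \<infinity>" for x
  proof -
    have "AE e in distr (aug_P P x \<Otimes>\<^sub>M rest) pieces_G switched. (\<lambda>k. pieces_time \<tau> k e) \<longlonglongrightarrow> \<infinity>"
      using assms unfolding nonaccumulating_def pieces_P_eq pieces_law_def by blast
    then show ?thesis
      by (rule AE_distrD[rotated]) (simp add: measurable_pair_rest[OF aug_P_prob(2)])
  qed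
  moreover have "Measurable.pred (aug_F \<Otimes>\<^sub>M rest) (\<lambda>z. (\<lambda>k. pieces_time \<tau> k (switched z)) \<longlonglongrightarrow> \<infinity>)"
    by measurable
  ultimately show ?thesis
    unfolding initial_rest by (subst AE_bind[OF measurable_prob_algebraD[OF joint_kernel]]) simp_all
qed

lemma switched_in_space: "z \<in> space (initial \<Otimes>\<^sub>M rest) \<Longrightarrow> switched z \<in> space pieces_G"
  using measurable_space[OF measurable_switched, of z] sets_eq_imp_space_eq[OF sets_initial_rest]
  by auto

text \<open>If the lengths before \<open>n\<close> are finite, all cycles up to \<open>n\<close>
  begin and none of their pieces is a dummy. The event can therefore be read from the independent
  pieces of \<open>chain\<close>.\<close>

lemma outcome_event_iff:
  assumes z: "z \<in> space (initial \<Otimes>\<^sub>M rest)"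
    and lim: "(\<lambda>k. pieces_time \<tau> k (switched z)) \<longlonglongrightarrow> \<infinity>"
  shows "\<tau> n (outcome z) < \<infinity> \<and> (\<forall>j\<le>n. cycle_process \<tau> j (outcome z) \<in> C j) \<longleftrightarrow>
    (\<forall>j\<le>n. killed (lifetime j (chain z)) (snd (chain z) j) \<in> C j \<and> (j < n \<longrightarrow> lifetime j (chain z) < \<infinity>))"
proof -
  note e = switched_in_space[OF z]
  have chain: "chain z \<in> space pieces_G"
    using measurable_space[OF measurable_chain, of z] z sets_eq_imp_space_eq[OF sets_initial_rest]
    by auto
  have "\<tau> n (outcome z) < \<infinity> \<longleftrightarrow> (\<forall>j<n. lifetime j (chain z) < \<infinity>)"
    unfolding outcome_def tau_controlled[OF e lim] pieces_time_switched pieces_time_finite_iff[OF chain] ..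
  moreover have "cycle_process \<tau> j (outcome z) = killed (lifetime j (chain z)) (snd (chain z) j)"
    if "\<forall>j<n. lifetime j (chain z) < \<infinity>" "j \<le> n" for j
  proof -
    have T: "pieces_time \<tau> j (chain z) < \<infinity>" unfolding pieces_time_finite_iff[OF chain] using that by simp
    then have piece: "snd (switched z) j = snd (chain z) j" by (cases j) simp_all
    then have "lifetime j (switched z) = lifetime j (chain z)"
      by (cases j) (simp_all only: lifetime_0 lifetime_Suc switched_simps(1) chain_simps(1))
    then show ?thesis
      using cycle_process_controlled[OF e lim, of j ebar] T piece
      by (simp only: outcome_def pieces_time_switched)
  qed
  ultimately show ?thesis by (metis order_le_less)
qed

section \<open>Factorisation of cycle events\<close>

text \<open>The flag \<open>b\<close> demands that the cycle ends. It is set for cycles before the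
  \<open>n\<close>-th and unset for the \<open>n\<close>-th, which may be infinite.\<close>

definition first_factor :: "bool \<Rightarrow> (real \<Rightarrow> 'e option) set \<Rightarrow> real" where
  "first_factor b C = measure initial
     {w \<in> space aug_F. killed (\<tau> 1 w) (snd w) \<in> C \<and> (b \<longrightarrow> \<tau> 1 w < \<infinity>)}"

definition later_factor :: "bool \<Rightarrow> nat \<Rightarrow> (real \<Rightarrow> 'e option) set \<Rightarrow> real" where
  "later_factor b j C = measure (fresh j)
     {u \<in> space path_F. killed (len (Suc j) u) u \<in> C \<and> (b \<longrightarrow> len (Suc j) u < \<infinity>)}"

definition factor :: "nat \<Rightarrow> nat \<Rightarrow> (real \<Rightarrow> 'e option) set \<Rightarrow> real" where
  "factor n j C = (case j of 0 \<Rightarrow> first_factor (0 < n) C | Suc i \<Rightarrow> later_factor (Suc i < n) i C)"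

definition chain_event :: "nat \<Rightarrow> (nat \<Rightarrow> (real \<Rightarrow> 'e option) set) \<Rightarrow> ('e aug \<times> (nat \<Rightarrow> 'e path \<times> 'e path)) set" where
  "chain_event n C = {z \<in> space (initial \<Otimes>\<^sub>M rest). \<forall>j\<le>n.
     killed (lifetime j (chain z)) (snd (chain z) j) \<in> C j \<and> (j < n \<longrightarrow> lifetime j (chain z) < \<infinity>)}"

lemma
  assumes C: "\<And>j. j \<le> n \<Longrightarrow> C j \<in> sets cycle_space"
  shows sets_chain_event: "chain_event n C \<in> sets (initial \<Otimes>\<^sub>M rest)"
    and measure_chain_event: "measure (initial \<Otimes>\<^sub>M rest) (chain_event n C) = (\<Prod>j\<le>n. factor n j (C j))"
proof -
  interpret init: prob_space initial by (rule initial_prob)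
  interpret rest': prob_space rest by (rule prob_rest)
  interpret J: pair_prob_space initial rest ..
  define A where "A = {w \<in> space aug_F. killed (\<tau> 1 w) (snd w) \<in> C 0 \<and> (0 < n \<longrightarrow> \<tau> 1 w < \<infinity>)}"
  define B where "B j = {u \<in> space path_F. killed (len (Suc j) u) u \<in> C (Suc j) \<and>
    (Suc j < n \<longrightarrow> len (Suc j) u < \<infinity>)}" for j
  define R where "R = {r \<in> space rest. \<forall>j\<in>{..<n}. r j \<in> B j \<times> cadlag}"
  have C0 [measurable]: "C 0 \<in> sets cycle_space" using C by simp
  have A: "A \<in> sets initial" unfolding sets_initial A_def by measurable
  have B: "B j \<in> sets path_F" if "j < n" for j
  proof -
    have [measurable]: "C (Suc j) \<in> sets cycle_space" "len (Suc j) \<in> borel_measurable path_F"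
      using C that measurable_len by simp_all
    show ?thesis unfolding B_def by measurable
  qed
  have BI: "B j \<times> cadlag \<in> sets (fresh j \<Otimes>\<^sub>M dummy)" if "j < n" for j
    using B[OF that] by (intro pair_measureI) (simp_all add: sets_fresh sets_dummy)
  have R: "R \<in> sets rest"
    unfolding R_def rest_def
  proof (rule sets.sets_Collect_finite_All)
    fix j assume j: "j \<in> {..<n}"
    have "(\<lambda>r. r j) -` (B j \<times> cadlag) \<inter> space (PiM UNIV (\<lambda>k. fresh k \<Otimes>\<^sub>M dummy))
        \<in> sets (PiM UNIV (\<lambda>k. fresh k \<Otimes>\<^sub>M dummy))"
      using j by (intro measurable_sets[OF measurable_component_singleton] BI) auto
    then show "{r \<in> space (PiM UNIV (\<lambda>k. fresh k \<Otimes>\<^sub>M dummy)). r j \<in> B j \<times> cadlag}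
        \<in> sets (PiM UNIV (\<lambda>k. fresh k \<Otimes>\<^sub>M dummy))"
      by (simp add: vimage_def Int_def conj_commute)
  qed simp
  have all_le: "(\<forall>j\<le>n. p j) \<longleftrightarrow> p 0 \<and> (\<forall>j<n. p (Suc j))" for p
    by (metis Suc_le_eq le0 not0_implies_Suc)
  \<comment> \<open>Cycle 0 is a condition on the initial factor and cycle \<open>j + 1\<close> one
    on the fresh half of coordinate \<open>j\<close>; the dummy halves are unconstrained.\<close>
  have E: "chain_event n C = A \<times> R"
    unfolding chain_event_def all_le A_def R_def B_def
    using sets_eq_imp_space_eq[OF sets_initial]
    by (auto simp: space_pair_measure lifetime_0 lifetime_Suc space_rest Pi_iff mem_Times_iff)
  show "chain_event n C \<in> sets (initial \<Otimes>\<^sub>M rest)"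
    unfolding E using A R by (rule pair_measureI)
  have "emeasure (initial \<Otimes>\<^sub>M rest) (chain_event n C) = emeasure initial A * emeasure rest R"
    unfolding E using A R by (rule rest'.emeasure_pair_measure_Times)
  also have "emeasure rest R = (\<Prod>j<n. emeasure (fresh j \<Otimes>\<^sub>M dummy) (B j \<times> cadlag))"
    unfolding R_def rest_def using BI by (intro rest.emeasure_PiM_Collect) auto
  also have "\<dots> = (\<Prod>j<n. ennreal (measure (fresh j) (B j)))"
  proof (rule prod.cong)
    fix j assume "j \<in> {..<n}"
    then show "emeasure (fresh j \<Otimes>\<^sub>M dummy) (B j \<times> cadlag) = ennreal (measure (fresh j) (B j))"
      using B[of j] prob_space.emeasure_space_1[OF prob_dummy]
        finite_measure.emeasure_eq_measure[OF prob_space.finite_measure[OF prob_fresh[of j]]]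
      by (simp add: emeasure_fresh_dummy)
  qed simp
  finally have "emeasure (initial \<Otimes>\<^sub>M rest) (chain_event n C) = ennreal (measure initial A * (\<Prod>j<n. measure (fresh j) (B j)))"
    by (simp add: init.emeasure_eq_measure prod_ennreal ennreal_mult prod_nonneg)
  then have "measure (initial \<Otimes>\<^sub>M rest) (chain_event n C) = measure initial A * (\<Prod>j<n. measure (fresh j) (B j))"
    by (simp add: measure_def prod_nonneg)
  also have "\<dots> = (\<Prod>j\<le>n. factor n j (C j))"
    unfolding prod.atMost_shift by (simp add: factor_def first_factor_def later_factor_def A_def B_def)
  finally show "measure (initial \<Otimes>\<^sub>M rest) (chain_event n C) = (\<Prod>j\<le>n. factor n j (C j))" .
qed

lemma controlled_P_init_prob: "prob_space (controlled_P_init P Q ebar zbar \<tau> Z \<nu>)"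
proof -
  have "outcome \<in> initial \<Otimes>\<^sub>M rest \<rightarrow>\<^sub>M aug_F"
    using measurable_outcome by (simp add: measurable_pair_rest[OF sets_initial])
  then show ?thesis
    unfolding controlled_P_init_eq by (intro prob_space.prob_space_distr prob_space_pair initial_prob prob_rest)
qed

lemma cycles_event_measure:
  assumes non: "nonaccumulating P Q ebar zbar \<tau> Z"
    and C: "\<And>j. j \<le> n \<Longrightarrow> C j \<in> sets cycle_space"
  shows "measure (controlled_P_init P Q ebar zbar \<tau> Z \<nu>)
      {w \<in> space aug_F. \<tau> n w < \<infinity> \<and> (\<forall>j\<le>n. cycle_process \<tau> j w \<in> C j)} =
    (\<Prod>j\<le>n. factor n j (C j))" (is "measure _ ?W = _")
proof -
  interpret init: prob_space initial by (rule initial_prob)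
  interpret rest': prob_space rest by (rule prob_rest)
  interpret J: pair_prob_space initial rest ..
  have out: "outcome \<in> initial \<Otimes>\<^sub>M rest \<rightarrow>\<^sub>M aug_F"
    using measurable_outcome by (simp add: measurable_pair_rest[OF sets_initial])
  have cyc: "{w \<in> space aug_F. \<forall>j\<in>{..n}. cycle_process \<tau> j w \<in> C j} \<in> sets aug_F"
  proof (rule sets.sets_Collect_finite_All)
    fix j assume j: "j \<in> {..n}"
    have "cycle_process \<tau> j -` C j \<inter> space aug_F \<in> sets aug_F"
      using j by (intro measurable_sets[OF measurable_cycle_process[OF measurable_tau] C]) simp
    then show "{w \<in> space aug_F. cycle_process \<tau> j w \<in> C j} \<in> sets aug_F"
      by (simp add: vimage_def Int_def conj_commute)
  qed simp
  have fin: "{w \<in> space aug_F. \<tau> n w < \<infinity>} \<in> sets aug_F" by measurable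
  have "?W = {w \<in> space aug_F. \<tau> n w < \<infinity>} \<inter> {w \<in> space aug_F. \<forall>j\<in>{..n}. cycle_process \<tau> j w \<in> C j}"
    by auto
  then have W: "?W \<in> sets aug_F" using cyc fin by auto
  have "measure (controlled_P_init P Q ebar zbar \<tau> Z \<nu>) ?W = measure (initial \<Otimes>\<^sub>M rest) (outcome -` ?W \<inter> space (initial \<Otimes>\<^sub>M rest))"
    unfolding controlled_P_init_eq by (rule measure_distr[OF out W])
  also have "\<dots> = measure (initial \<Otimes>\<^sub>M rest) (chain_event n C)"
  proof (rule J.finite_measure_eq_AE)
    show "AE z in initial \<Otimes>\<^sub>M rest. (z \<in> outcome -` ?W \<inter> space (initial \<Otimes>\<^sub>M rest)) = (z \<in> chain_event n C)"
      using AE_nonaccumulating[OF non] AE_space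
    proof eventually_elim
      case (elim z)
      then show ?case
        using outcome_event_iff[OF elim(2,1), of n C] measurable_space[OF out elim(2)]
        by (simp add: chain_event_def)
    qed
  qed (use measurable_sets[OF out W] sets_chain_event[OF C] in simp_all)
  also have "\<dots> = (\<Prod>j\<le>n. factor n j (C j))" by (rule measure_chain_event) (rule C)
  finally show ?thesis .
qed

lemma sets_controlled_P_init: "sets (controlled_P_init P Q ebar zbar \<tau> Z \<nu>) = sets aug_F"
  unfolding controlled_P_init_eq by simp

lemma indep_cycles_given:
  fixes n :: nat and zbar :: 'z
  defines "Pnu \<equiv> controlled_P_init P Q ebar zbar \<tau> Z \<nu>"
  defines "H \<equiv> {w \<in> space Pnu. \<tau> n w < \<infinity>}"
  assumes non: "nonaccumulating P Q ebar zbar \<tau> Z" and pos: "emeasure Pnu H > 0"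
  shows "prob_space.indep_vars (uniform_measure Pnu H) (\<lambda>_. cycle_space) (cycle_process \<tau>) {..n}"
proof -
  interpret prob_space Pnu unfolding Pnu_def by (rule controlled_P_init_prob)
  have sets: "sets Pnu = sets aug_F" unfolding Pnu_def by (rule sets_controlled_P_init)
  have H: "H = {w \<in> space aug_F. \<tau> n w < \<infinity>}"
    unfolding H_def sets_eq_imp_space_eq[OF sets] ..
  show ?thesis
  proof (rule indep_vars_uniform_measure[where a="factor n", OF _ _ pos])
    show "cycle_process \<tau> j \<in> Pnu \<rightarrow>\<^sub>M cycle_space" for j
      using measurable_cycle_process[OF measurable_tau] by (simp cong: measurable_cong_sets add: sets)
    show "H \<in> sets Pnu" unfolding H sets by measurable
    fix C :: "nat \<Rightarrow> (real \<Rightarrow> 'e option) set" assume C: "\<And>j. j \<le> n \<Longrightarrow> C j \<in> sets cycle_space"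
    have "{w \<in> H. \<forall>j\<le>n. cycle_process \<tau> j w \<in> C j} =
        {w \<in> space aug_F. \<tau> n w < \<infinity> \<and> (\<forall>j\<le>n. cycle_process \<tau> j w \<in> C j)}"
      unfolding H by auto
    then show "measure Pnu {w \<in> H. \<forall>j\<le>n. cycle_process \<tau> j w \<in> C j} = (\<Prod>j\<le>n. factor n j (C j))"
      unfolding Pnu_def using cycles_event_measure[OF non C] by simp
  qed
qed

text \<open>If intervention \<open>n\<close> happens almost surely, the conditioning event has full
  measure and conditioning on it changes nothing. Independence of an infinite family concerns finite
  subfamilies only, and the case \<open>n = Max J\<close> covers the finite index set
  \<open>J\<close>.\<close>

lemma indep_cycles:
  fixes zbar :: 'z
  defines "Pnu \<equiv> controlled_P_init P Q ebar zbar \<tau> Z \<nu>"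
  assumes non: "nonaccumulating P Q ebar zbar \<tau> Z"
  shows "prob_space.indep_vars Pnu (\<lambda>_. cycle_space) (cycle_process \<tau>) {k. AE w in Pnu. \<tau> k w < \<infinity>}"
proof -
  interpret prob_space Pnu unfolding Pnu_def by (rule controlled_P_init_prob)
  have sets: "sets Pnu = sets aug_F" unfolding Pnu_def by (rule sets_controlled_P_init)
  have upto: "indep_vars (\<lambda>_. cycle_space) (cycle_process \<tau>) {..n}" if n: "AE w in Pnu. \<tau> n w < \<infinity>" for n
  proof -
    define H where "H = {w \<in> space Pnu. \<tau> n w < \<infinity>}"
    have H: "H \<in> sets Pnu" unfolding H_def sets_eq_imp_space_eq[OF sets] sets by measurable
    have AE_H: "AE w in Pnu. w \<in> H" using n AE_space by eventually_elim (simp add: H_def)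
    then have "emeasure Pnu H = 1" using H by (simp add: emeasure_eq_1_AE)
    then have "prob_space.indep_vars (uniform_measure Pnu H) (\<lambda>_. cycle_space) (cycle_process \<tau>) {..n}"
      using indep_cycles_given[OF non, of n] by (simp add: Pnu_def H_def)
    then show ?thesis
      unfolding uniform_measure_full[OF prob_space_axioms H AE_H] .
  qed
  let ?F = "\<lambda>i. {cycle_process \<tau> i -` A \<inter> space Pnu |A. A \<in> sets cycle_space}"
  have "indep_sets ?F {k. AE w in Pnu. \<tau> k w < \<infinity>}"
    unfolding indep_sets_finite_index_sets[of _ "{k. AE w in Pnu. \<tau> k w < \<infinity>}"]
  proof (intro allI impI)
    fix J assume J: "J \<subseteq> {k. AE w in Pnu. \<tau> k w < \<infinity>}" "J \<noteq> {}" "finite J"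
    then have "AE w in Pnu. \<tau> (Max J) w < \<infinity>" using Max_in by blast
    from upto[OF this] have "indep_sets ?F {..Max J}" by (simp add: indep_vars_def2)
    then show "indep_sets ?F J" by (rule indep_sets_mono_index[rotated]) (use J in auto)
  qed
  moreover have "random_variable cycle_space (cycle_process \<tau> k)" for k
    using measurable_cycle_process[OF measurable_tau] by (simp cong: measurable_cong_sets add: sets)
  ultimately show ?thesis by (simp add: indep_vars_def2)
qed

end

end

theorem proposition4p2:
  fixes P :: "'e::polish_space \<Rightarrow> 'e path measure"
    and MZ :: "'z measure"
    and Q :: "'e \<times> 'z \<Rightarrow> 'e measure"
    and \<tau> :: "nat \<Rightarrow> 'e aug \<Rightarrow> ennreal"
    and Z :: "nat \<Rightarrow> 'e aug \<Rightarrow> 'z"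
    and ebar :: 'e and zbar :: 'z
    and \<nu> :: "'e measure"
  assumes "markov_family P"
    and "\<And>x. AE w in P x. continuous_on {0..} w"
    and "Q \<in> borel \<Otimes>\<^sub>M MZ \<rightarrow>\<^sub>M prob_algebra borel"
    and "zbar \<in> space MZ"
    and "independent_cycles_policy MZ Q \<tau> Z"
    and "nonaccumulating P Q ebar zbar \<tau> Z"
    and "prob_space \<nu>" and "sets \<nu> = sets borel"
  shows "let Pnu = controlled_P_init P Q ebar zbar \<tau> Z \<nu>;
             happens = (\<lambda>n. {w \<in> space Pnu. \<tau> n w < \<infinity>})
         in prob_space Pnu \<and>
            prob_space.indep_vars Pnu (\<lambda>_. cycle_space) (cycle_process \<tau>)
              {k. AE w in Pnu. \<tau> k w < \<infinity>} \<and>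
            (\<forall>n. emeasure Pnu (happens n) > 0 \<longrightarrow>
               prob_space.indep_vars (uniform_measure Pnu (happens n))
                 (\<lambda>_. cycle_space) (cycle_process \<tau>) {..n})"
proof -
  interpret controlled_cycles MZ Q \<tau> Z P ebar
    by unfold_locales (use assms in auto)
  show ?thesis
    unfolding Let_def
    using controlled_P_init_prob[OF assms(7,8)] indep_cycles[OF assms(7,8,6)]
      indep_cycles_given[OF assms(7,8,6)] by blast
qed

end
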